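(* Let $k$ be a positive integer. For every pair partition $\mathfrak{m}\in\mathcal{P}_2(2k)$ and every nonnegative integer $g$, $$\#P(\mathfrak{m},|\mathfrak{m}|+2g)\ge(2k-2)^g\,\#P(\mathfrak{m},|\mathfrak{m}|),\qquad \#P(\mathfrak{m},|\mathfrak{m}|+g)\le(12k^{7/2})^g\,\#P(\mathfrak{m},|\mathfrak{m}|).$$
   Context: $\mathcal{P}_2(2k)$ is the set of pair partitions of $\{1,\dots,2k\}$; $\mathcal{P}_2(0)=\{\emptyset\}$; $S_{2k}$ acts on it by applying the permutation to every element of every block. The coset-type of $\mathfrak{m}$ is the partition $\mu$ of $k$ such that the connected components of the graph on $\{1,\dots,2k\}$ whose edges are the blocks of $\mathfrak{e}_k=\{1,2\}\cdots\{2k-1,2k\}$ and of $\mathfrak{m}$ have sizes $2\mu_1,2\mu_2,\dots$; $|\mathfrak{m}|=k-\ell(\mu)$. The orthogonal Weingarten graph has vertex set $\bigsqcup_{k\ge0}\mathcal{P}_2(2k)$, a solid arrow $\mathfrak{m}\to(i,2k-1).\mathfrak{m}$ for every $\mathfrak{m}\in\mathcal{P}_2(2k)$ and $1\le i<2k-1$, and a dashed arrow $\mathfrak{m}\dashrightarrow\mathfrak{m}^{\downarrow}$ whenever $\{2k-1,2k\}\in\mathfrak{m}$, with $\mathfrak{m}^{\downarrow}\in\mathcal{P}_2(2k-2)$ being $\mathfrak{m}$ with that block removed. $P(\mathfrak{m},l)$ is the set of paths $(\mathfrak{m}_0=\mathfrak{m},\dots,\mathfrak{m}_{l+k}=\emptyset)$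 following arrows at each step, using $l$ solid and $k$ dashed arrows. *)

theory Defs
  imports Complex_Main "HOL-Library.Multiset" "HOL-Library.Disjoint_Sets"
    "HOL-Combinatorics.Combinatorics"
begin

text \<open>The set \<open>P\<^sub>2(2k)\<close> of pair partitions of \<open>{1,\<dots>,2k}\<close>; in particular
  \<open>pair_partitions 0 = {{}}\<close>.\<close>

definition pair_partitions :: "nat \<Rightarrow> nat set set set" where
  "pair_partitions k = {m. partition_on {1..2*k} m \<and> (\<forall>B\<in>m. card B = 2)}"

definition perm_act :: "(nat \<Rightarrow> nat) \<Rightarrow> nat set set \<Rightarrow> nat set set" where
  "perm_act \<sigma> m = (\<lambda>B. \<sigma> ` B) ` m"

definition id_pairing :: "nat \<Rightarrow> nat set set" where
  "id_pairing k = (\<lambda>i. {2*i - 1, 2*i}) ` {1..k}"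

definition pairing_adj :: "nat \<Rightarrow> nat set set \<Rightarrow> (nat \<times> nat) set" where
  "pairing_adj k m = {(x, y). {x, y} \<in> id_pairing k \<union> m}"

definition pairing_components :: "nat \<Rightarrow> nat set set \<Rightarrow> nat set set" where
  "pairing_components k m = (\<lambda>x. (pairing_adj k m)\<^sup>* `` {x}) ` {1..2*k}"

text \<open>The coset-type, as a multiset of parts: each component of size \<open>2 * \<mu>\<^sub>i\<close> contributes
  the part \<open>\<mu>\<^sub>i\<close>, so the number of parts \<open>\<ell>(\<mu>)\<close> is the size of the multiset.\<close>

definition coset_type :: "nat \<Rightarrow> nat set set \<Rightarrow> nat multiset" where
  "coset_type k m = image_mset (\<lambda>C. card C div 2) (mset_set (pairing_components k m))"

definition pairing_norm :: "nat \<Rightarrow> nat set set \<Rightarrow> nat" where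
  "pairing_norm k m = k - size (coset_type k m)"

text \<open>The vertices of the orthogonal Weingarten graph are the elements of the sets
  \<open>pair_partitions k\<close>. These sets are pairwise disjoint, as \<open>\<Union>m = {1..2*k}\<close> determines \<open>k\<close>,
  so no tags are needed for the disjoint union. A solid arrow may be a loop
  (when \<open>{i, 2*k - 1} \<in> m\<close>), but different \<open>i\<close> always give different targets: there are no
  parallel arrows, and the arrows can be given by relations.\<close>

definition solid_arrow :: "nat set set \<Rightarrow> nat set set \<Rightarrow> bool" where
  "solid_arrow m m' \<longleftrightarrow>
     (\<exists>k i. m \<in> pair_partitions k \<and> 1 \<le> i \<and> i < 2*k - 1 \<and>
            m' = perm_act (transpose i (2*k - 1)) m)"

definition dashed_arrow :: "nat set set \<Rightarrow> nat set set \<Rightarrow> bool" where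
  "dashed_arrow m m' \<longleftrightarrow>
     (\<exists>k\<ge>1. m \<in> pair_partitions k \<and> {2*k - 1, 2*k} \<in> m \<and> m' = m - {{2*k - 1, 2*k}})"

definition weingarten_paths :: "nat \<Rightarrow> nat set set \<Rightarrow> nat \<Rightarrow> nat set set list set" where
  "weingarten_paths k m l =
     {p. length p = l + k + 1 \<and> p ! 0 = m \<and> p ! (l + k) = {} \<and>
         (\<forall>j<l + k. solid_arrow (p ! j) (p ! Suc j) \<or> dashed_arrow (p ! j) (p ! Suc j)) \<and>
         card {j. j < l + k \<and> solid_arrow (p ! j) (p ! Suc j)} = l \<and>
         card {j. j < l + k \<and> dashed_arrow (p ! j) (p ! Suc j)} = k}"

end

theory Submission imports Defs begin

text \<open>
  Lower bound: a detour \<open>m \<rightarrow> (i,2k-1).m \<rightarrow> m\<close> in front of a path adds two solid arrows, and the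
  \<open>2k - 2\<close> choices of \<open>i\<close> give different paths.

  Upper bound: let \<open>2a\<close> be the size of the component of \<open>2k - 1\<close>. For each \<open>1 \<le> s < a\<close>, exactly one
  solid arrow splits this component into components of sizes \<open>2s\<close> and \<open>2(a - s)\<close>, which lowers the
  norm by one; every other solid arrow either keeps all components or merges two of them. By Catalan's
  recursion, the number \<open>W(m)\<close> of geodesics from \<open>m\<close> to the empty pairing is the product of
  the Catalan numbers with indices \<open>\<mu>\<^sub>i - 1\<close>, and merging two components changes \<open>W\<close> by a factor of
  at most \<open>k\<^sup>3\<close>. Cutting a path at its first arrow that does not lower the norm reduces the excess by
  one or two, at the cost of a factor of at most \<open>(2k - 1)(2k - 2)\<close>, and of a further \<open>k\<^sup>3\<close> in the
  case of a merge, where the excess drops by two.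
\<close>

subsection \<open>Catalan numbers\<close>

text \<open>Whether a swap splits a component depends on orientation. Run round the cycle from 2k -
  1, first along its edge to 2k, and list the endpoint of each edge of \<open>id_pairing k\<close>
  that is met first. Swapping 2k - 1 with another listed point cuts the cycle in two; swapping it
  with the mate of a listed point only reverses a segment. This gives exactly a - 1 splitting
  arrows. The dashed arrow exists exactly when a = 1, and it preserves both the norm and W. It thus
  replaces the Catalan sum where that sum is empty, and W obeys the recursion of the path counts.
  The obstacle for the upper bound is that a merge can increase W. But a merge also uses up two
  units of excess, so one factor B per unit is enough as soon as B is at least k^3 and at least
  (2k-1)(2k-2): the first pays for the extra unit, the second for the choice of position and arrow.
  Both conditions hold for B = 12 k^(7/2). Since dashed arrows lower k while B must not change, they
  are imposed for a fixed K that bounds k.\<close>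

definition catalan :: "nat \<Rightarrow> real" where
  "catalan n = real (2 * n choose n) / real (Suc n)"

lemma catalan_0 [simp]: "catalan 0 = 1"
  by (simp add: catalan_def)

lemma catalan_pos: "catalan n > 0"
  by (simp add: catalan_def)

text \<open>With this first-order recurrence, the telescoping identity behind the convolution
  becomes an identity of rational functions.\<close>

lemma central_binomial_Suc:
  "(real n + 1) * real (2 * Suc n choose Suc n) = 2 * (2 * real n + 1) * real (2 * n choose n)"
proof -
  have c: "real (2 * m choose m) * (fact m * fact m) = fact (2 * m)" for m
    using binomial_fact_lemma[of m "2 * m"]
    by (metis (no_types, lifting) add_diff_cancel_left' le_add1 mult.commute mult_2 of_nat_fact of_nat_mult)
  have "real (2 * Suc n choose Suc n) * ((real n + 1)\<^sup>2 * (fact n * fact n))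
      = (2 * real n + 2) * (2 * real n + 1) * fact (2 * n)"
    using c[of "Suc n"] by (simp add: algebra_simps power2_eq_square)
  also have "\<dots> = (2 * real n + 2) * (2 * real n + 1) * real (2 * n choose n) * (fact n * fact n)"
    using c[of n] by simp
  finally have "real (2 * Suc n choose Suc n) * (real n + 1)\<^sup>2
      = (2 * real n + 2) * (2 * real n + 1) * real (2 * n choose n)"
    by (simp only: mult.assoc[symmetric] mult_cancel_right) simp
  then have "(real n + 1) * ((real n + 1) * real (2 * Suc n choose Suc n))
      = (real n + 1) * (2 * (2 * real n + 1) * real (2 * n choose n))"
    by (simp only: power2_eq_square) (simp only: algebra_simps)
  then show ?thesis
    by (simp only: mult_cancel_left) linarith
qed

text \<open>The sum telescopes: \<open>G\<close> is Gosper's antiderivative of the summand.\<close>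

lemma catalan_convolution: "(\<Sum>i\<le>n. catalan i * catalan (n - i)) = catalan (Suc n)"
proof -
  define c where "c j = real (2 * j choose j)" for j
  define G where "G j = c j * c (Suc n - j) * (2 * real j - real n - 1)
      / (2 * (real n + 1) * (real n + 2))" for j
  have step: "catalan i * catalan (n - i) = G (Suc i) - G i" if "i \<le> n" for i
  proof -
    obtain d where n: "n = i + d" using \<open>i \<le> n\<close> le_Suc_ex by blast
    have c: "c (Suc j) = 2 * (2 * real j + 1) * c j / (real j + 1)" for j
      using central_binomial_Suc[of j] unfolding c_def by (simp add: field_simps)
    have "Suc n - Suc i = d" "Suc n - i = Suc d" by (auto simp: n)
    then have "G (Suc i) - G i
        = (c (Suc i) * c d * (real i - real d + 1) - c i * c (Suc d) * (real i - real d - 1))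
          / (2 * (real n + 1) * (real n + 2))"
      unfolding G_def by (simp add: n diff_divide_distrib[symmetric])
    also have "\<dots> = c i * c d / ((real i + 1) * (real d + 1))"
    proof -
      have "real i + 1 \<noteq> 0" "real d + 1 \<noteq> 0" "real i + real d + 1 \<noteq> 0" "real i + real d + 2 \<noteq> 0"
        by linarith+
      then show ?thesis unfolding c n of_nat_add
        by (simp add: divide_simps) algebra
    qed
    also have "\<dots> = catalan i * catalan (n - i)"
      by (simp add: catalan_def c_def n add.commute)
    finally show ?thesis ..
  qed
  have "(\<Sum>i\<le>n. catalan i * catalan (n - i)) = (\<Sum>i<Suc n. G (Suc i) - G i)"
    unfolding lessThan_Suc_atMost by (rule sum.cong) (auto simp: step)
  also have "\<dots> = G (Suc n) - G 0"
    by (rule sum_lessThan_telescope)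
  \<comment> \<open>The two boundary terms are opposite, and each has absolute value half of
    \<open>catalan (Suc n)\<close>.\<close>
  also have "\<dots> = catalan (Suc n)"
    by (simp add: G_def catalan_def c_def divide_simps del: binomial_Suc_Suc) (simp add: algebra_simps)
  finally show ?thesis .
qed

text \<open>\<open>catalan n\<close> lies between 4^n / ((2n+1)(n+1)) and 4^n / (n+1). In the
  comparison the powers of 4 leave a single factor 4, and what remains to be bounded is at most
  (4ab)^2, hence at most (a+b)^4 by the inequality of arithmetic and geometric means. One factor a+b
  is absorbed by the denominator of \<open>catalan (a + b - 1)\<close>.\<close>

lemma catalan_merge_le:
  assumes "a \<ge> 1" "b \<ge> 1"
  shows "catalan (a + b - 1) \<le> (real a + real b) ^ 3 * (catalan (a - 1) * catalan (b - 1))"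
proof -
  have lower: "4 ^ n / (2 * real n + 1) \<le> real (2 * n choose n)" for n
  proof (cases "n = 0")
    case False
    then have "(4::real) ^ n / (2 * real n + 1) \<le> 4 ^ n / (2 * real n)"
      by (intro divide_left_mono) auto
    also have "\<dots> \<le> real (2 * n choose n)"
      using False by (intro central_binomial_lower_bound) auto
    finally show ?thesis .
  qed auto
  have upper: "real (2 * n choose n) \<le> 4 ^ n" for n
  proof -
    have "(2 * n choose n) \<le> (\<Sum>k\<le>2 * n. 2 * n choose k)"
      by (rule member_le_sum) auto
    also have "\<dots> = 2 ^ (2 * n)" by (rule choose_row_sum)
    finally show ?thesis
      by (simp add: power_mult)
  qed
  obtain x y where [simp]: "a = Suc x" "b = Suc y"
    using assms by (metis Suc_le_D One_nat_def)
  have le: "4 ^ n / ((2 * real n + 1) * (real n + 1)) \<le> catalan n" for n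
    using divide_right_mono[OF lower, of "real n + 1" n] by (simp add: catalan_def add.commute)
  have "catalan (a + b - 1) \<le> 4 ^ (x + y + 1) / (real a + real b)"
    unfolding catalan_def using divide_right_mono[OF upper, of "real a + real b" "x + y + 1"]
    by (simp add: algebra_simps)
  also have "\<dots> \<le> (real a + real b) ^ 3
      * ((4 ^ x / ((2 * real x + 1) * (real x + 1))) * (4 ^ y / ((2 * real y + 1) * (real y + 1))))"
  proof -
    define p q where "p = real x" and "q = real y"
    have nn: "p \<ge> 0" "q \<ge> 0" by (simp_all add: p_def q_def)
    define s where "s = p + q + 2"
    have am: "4 * ((p + 1) * (q + 1)) \<le> s\<^sup>2"
      unfolding s_def using zero_le_power2[of "p - q"] by (simp add: power2_eq_square algebra_simps)
    have "((2 * p + 1) * (p + 1)) * ((2 * q + 1) * (q + 1)) * 4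
        \<le> ((2 * (p + 1)) * (p + 1)) * ((2 * (q + 1)) * (q + 1)) * 4"
      using nn by (intro mult_mono mult_nonneg_nonneg) auto
    also have "\<dots> = (4 * ((p + 1) * (q + 1)))\<^sup>2"
      by (simp add: power2_eq_square algebra_simps)
    also have "\<dots> \<le> (s\<^sup>2)\<^sup>2"
      using am nn by (intro power_mono) auto
    also have "\<dots> = s ^ 4" by simp
    finally have key: "((2 * p + 1) * (p + 1)) * ((2 * q + 1) * (q + 1)) * 4 \<le> s ^ 4" .
    have "4 / s \<le> s ^ 3 / (((2 * p + 1) * (p + 1)) * ((2 * q + 1) * (q + 1)))"
      using key nn by (simp add: s_def pos_le_divide_eq pos_divide_le_eq divide_simps)
        (simp add: eval_nat_numeral mult_ac)
    then have "4 ^ (x + y) * (4 / s)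
        \<le> 4 ^ (x + y) * (s ^ 3 / (((2 * p + 1) * (p + 1)) * ((2 * q + 1) * (q + 1))))"
      by (intro mult_left_mono) auto
    then show ?thesis
      by (simp add: s_def p_def q_def power_add mult_ac add_ac)
  qed
  also have "\<dots> \<le> (real a + real b) ^ 3 * (catalan x * catalan y)"
    by (intro mult_left_mono mult_mono le) (auto simp: catalan_pos less_imp_le)
  finally show ?thesis by simp
qed

subsection \<open>Counting paths by their first arrow\<close>

abbreviation swap_last :: "nat \<Rightarrow> nat \<Rightarrow> nat set set \<Rightarrow> nat set set" where
  "swap_last k i m \<equiv> perm_act (transpose i (2 * k - 1)) m"

section \<open>Pair partitions and the action of swaps\<close>

lemma pair_partitions_0: "pair_partitions 0 = {{}}"
  by (auto simp: pair_partitions_def partition_on_empty)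

lemma pair_partitions_unique:
  assumes "m \<in> pair_partitions k" "m \<in> pair_partitions k'"
  shows "k = k'"
proof -
  have "{1..2 * k} = {1..2 * k'}"
    using assms partition_onD1 unfolding pair_partitions_def by (metis (mono_tags, lifting) mem_Collect_eq)
  then have "card {1..2 * k} = card {1..2 * k'}" by (rule arg_cong)
  then show ?thesis by simp
qed

lemma perm_act_in_pair_partitions:
  assumes m: "m \<in> pair_partitions k" and \<sigma>: "\<sigma> permutes {1..2 * k}"
  shows "perm_act \<sigma> m \<in> pair_partitions k"
proof -
  have inj: "inj \<sigma>" using \<sigma> by (rule permutes_inj)
  have "partition_on (\<sigma> ` {1..2 * k}) ((`) \<sigma> ` m - {{}})"
    using m inj by (intro partition_on_inj_image) (auto simp: pair_partitions_def inj_on_def)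
  moreover have "{} \<notin> m"
    using m by (auto simp: pair_partitions_def partition_on_def)
  then have "(`) \<sigma> ` m - {{}} = perm_act \<sigma> m"
    by (auto simp: perm_act_def)
  ultimately have "partition_on {1..2 * k} (perm_act \<sigma> m)"
    by (simp only: permutes_image[OF \<sigma>])
  moreover have "card B = 2" if "B \<in> perm_act \<sigma> m" for B
    using that m inj by (auto simp: perm_act_def pair_partitions_def card_image inj_on_subset)
  ultimately show ?thesis by (simp add: pair_partitions_def)
qed

lemma swap_last_in_pair_partitions:
  assumes "m \<in> pair_partitions k" "i \<in> {1..<2 * k - 1}"
  shows "swap_last k i m \<in> pair_partitions k"
  using assms by (intro perm_act_in_pair_partitions permutes_swap_id) auto

lemma remove_last_in_pair_partitions:
  assumes m: "m \<in> pair_partitions k" and k: "k \<ge> 1" and b: "{2 * k - 1, 2 * k} \<in> m"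
  shows "m - {{2 * k - 1, 2 * k}} \<in> pair_partitions (k - 1)"
proof -
  let ?b = "{2 * k - 1, 2 * k}"
  have p: "partition_on {1..2 * k} m" using m by (simp add: pair_partitions_def)
  have d: "disjnt ?b (\<Union>(m - {?b}))"
    unfolding disjnt_Union2
  proof
    fix B assume "B \<in> m - {?b}"
    then show "disjnt ?b B"
      using pairwiseD[OF partition_onD2[OF p], of ?b B] b by auto
  qed
  have "partition_on {1..2 * k} (insert ?b (m - {?b}))"
    using p b by (simp add: insert_absorb)
  then have "partition_on ({1..2 * k} - ?b) (m - {?b})"
    unfolding partition_on_insert[OF d] by blast
  moreover have "{1..2 * k} - ?b = {1..2 * (k - 1)}"
    using k by auto
  ultimately show ?thesis using m by (auto simp: pair_partitions_def)
qed

lemma doubleton_in_perm_act_transpose: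
  "{x, y} \<in> perm_act (transpose i j) m \<longleftrightarrow> {transpose i j x, transpose i j y} \<in> m"
proof
  assume "{x, y} \<in> perm_act (transpose i j) m"
  then obtain B where B: "B \<in> m" "{x, y} = transpose i j ` B"
    by (auto simp: perm_act_def)
  have "transpose i j ` {x, y} = transpose i j ` transpose i j ` B" by (simp only: B(2))
  also have "\<dots> = B" unfolding image_image by simp
  finally have "{transpose i j x, transpose i j y} = B" by simp
  then show "{transpose i j x, transpose i j y} \<in> m" using B(1) by (simp only:)
next
  assume "{transpose i j x, transpose i j y} \<in> m"
  then have "transpose i j ` {transpose i j x, transpose i j y} \<in> perm_act (transpose i j) m"
    unfolding perm_act_def by (rule imageI)
  then show "{x, y} \<in> perm_act (transpose i j) m" by simp
qed

lemma perm_act_transpose_twice: "perm_act (transpose i j) (perm_act (transpose i j) m) = m"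
  by (simp add: perm_act_def image_image)

lemma pair_unique:
  assumes "m \<in> pair_partitions k" "{x, y} \<in> m" "{x, z} \<in> m"
  shows "y = z"
proof -
  have p: "disjoint m" using assms(1) by (auto simp: pair_partitions_def partition_on_def)
  have "{x, y} = {x, z}"
    using pairwiseD[OF p assms(2,3)] by (auto simp: disjnt_def)
  then show ?thesis by (auto simp: doubleton_eq_iff)
qed

lemma pair_distinct:
  assumes "m \<in> pair_partitions k" "{x, y} \<in> m"
  shows "x \<noteq> y"
  using assms by (auto simp: pair_partitions_def)

lemma pair_mem:
  assumes "m \<in> pair_partitions k" "{x, y} \<in> m"
  shows "x \<in> {1..2 * k}" "y \<in> {1..2 * k}"
proof -
  have "{x, y} \<subseteq> {1..2 * k}"
    using assms by (auto simp: pair_partitions_def partition_on_def)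
  then show "x \<in> {1..2 * k}" "y \<in> {1..2 * k}" by blast+
qed

lemma ex_partner:
  assumes m: "m \<in> pair_partitions k" and x: "x \<in> {1..2 * k}"
  obtains y where "{x, y} \<in> m"
proof -
  obtain B where B: "B \<in> m" "x \<in> B"
    using m x unfolding pair_partitions_def partition_on_def by blast
  then have "card B = 2" using m by (auto simp: pair_partitions_def)
  then obtain u v where "B = {u, v}" by (auto simp: card_2_iff)
  with B that show ?thesis by (metis insert_commute insertE singletonD)
qed

text \<open>The index \<open>i\<close> is read off the new partner of the old partner \<open>p\<close> of \<open>2k-1\<close>: this is \<open>i\<close>
  if \<open>i \<noteq> p\<close>, and \<open>2k-1\<close> if \<open>i = p\<close>.\<close>

lemma inj_on_swap_last:
  assumes m: "m \<in> pair_partitions k"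
  shows "inj_on (\<lambda>i. swap_last k i m) {1..<2 * k - 1}"
proof (rule inj_onI)
  fix i j assume i: "i \<in> {1..<2 * k - 1}" and j: "j \<in> {1..<2 * k - 1}"
    and eq: "swap_last k i m = swap_last k j m"
  let ?v = "2 * k - 1"
  have "?v \<in> {1..2 * k}" using i by auto
  then obtain p where p: "{?v, p} \<in> m" using ex_partner[OF m] by blast
  have pv: "p \<noteq> ?v" using pair_distinct[OF m p] by simp
  have *: "{p, if r = p then ?v else r} \<in> swap_last k r m" if "r \<in> {1..<2 * k - 1}" for r
  proof -
    have "transpose r ?v (if r = p then ?v else r) = ?v \<or> r = p" by simp
    then show ?thesis using p pv that
      unfolding doubleton_in_perm_act_transpose by (cases "r = p") (simp_all add: insert_commute)
  qed
  have "(if i = p then ?v else i) = (if j = p then ?v else j)"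
    using pair_unique[OF swap_last_in_pair_partitions[OF m i] *[OF i]] *[OF j] eq by simp
  moreover have "i \<noteq> ?v" "j \<noteq> ?v" using i j by simp_all
  ultimately show "i = j" by metis
qed

section \<open>Arrows and the recursion for path counts\<close>

lemma solid_arrow_iff:
  assumes "m \<in> pair_partitions k"
  shows "solid_arrow m m' \<longleftrightarrow> (\<exists>i\<in>{1..<2 * k - 1}. m' = swap_last k i m)"
proof
  assume "solid_arrow m m'"
  then obtain k' i where *: "m \<in> pair_partitions k'" "1 \<le> i" "i < 2 * k' - 1"
    "m' = swap_last k' i m" unfolding solid_arrow_def by blast
  have "k' = k" using *(1) assms by (rule pair_partitions_unique)
  with * show "\<exists>i\<in>{1..<2 * k - 1}. m' = swap_last k i m" by auto
next
  assume "\<exists>i\<in>{1..<2 * k - 1}. m' = swap_last k i m"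
  then obtain i where "1 \<le> i" "i < 2 * k - 1" "m' = swap_last k i m" by auto
  then show "solid_arrow m m'" using assms unfolding solid_arrow_def by blast
qed

lemma dashed_arrow_iff:
  assumes "m \<in> pair_partitions k"
  shows "dashed_arrow m m' \<longleftrightarrow>
    k \<ge> 1 \<and> {2 * k - 1, 2 * k} \<in> m \<and> m' = m - {{2 * k - 1, 2 * k}}"
proof
  assume "dashed_arrow m m'"
  then obtain k' where *: "k' \<ge> 1" "m \<in> pair_partitions k'" "{2 * k' - 1, 2 * k'} \<in> m"
    "m' = m - {{2 * k' - 1, 2 * k'}}" unfolding dashed_arrow_def by blast
  have "k' = k" using *(2) assms by (rule pair_partitions_unique)
  with * show "k \<ge> 1 \<and> {2 * k - 1, 2 * k} \<in> m \<and> m' = m - {{2 * k - 1, 2 * k}}" by simp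
next
  assume "k \<ge> 1 \<and> {2 * k - 1, 2 * k} \<in> m \<and> m' = m - {{2 * k - 1, 2 * k}}"
  then show "dashed_arrow m m'" using assms unfolding dashed_arrow_def by blast
qed

text \<open>A solid arrow keeps k and a dashed one lowers it, so no step of a path enters both
  cardinalities in \<open>weingarten_paths\<close>.\<close>

lemma not_solid_and_dashed: "\<not> (solid_arrow m m' \<and> dashed_arrow m m')"
proof
  assume a: "solid_arrow m m' \<and> dashed_arrow m m'"
  then obtain k where m: "m \<in> pair_partitions k" unfolding solid_arrow_def by blast
  from a have "dashed_arrow m m'" ..
  then have k: "k \<ge> 1" "m' \<in> pair_partitions (k - 1)"
    unfolding dashed_arrow_iff[OF m] using remove_last_in_pair_partitions[OF m] by blast+
  from a obtain i where "i \<in> {1..<2 * k - 1}" "m' = swap_last k i m"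
    unfolding solid_arrow_iff[OF m] by blast
  then have "m' \<in> pair_partitions k"
    using swap_last_in_pair_partitions[OF m] by simp
  then have "k = k - 1" using k(2) by (rule pair_partitions_unique)
  then show False using k(1) by simp
qed

lemma card_less_Suc_shift:
  "card {j. j < Suc n \<and> P j} = (if P 0 then 1 else 0) + card {j. j < n \<and> P (Suc j)}"
proof -
  have "{j. j < Suc n \<and> P j} = {j::nat. j = 0 \<and> P 0} \<union> Suc ` {j. j < n \<and> P (Suc j)}"
  proof (intro set_eqI)
    fix x
    show "x \<in> {j. j < Suc n \<and> P j} \<longleftrightarrow> x \<in> {j::nat. j = 0 \<and> P 0} \<union> Suc ` {j. j < n \<and> P (Suc j)}"
      by (cases x) auto
  qed
  moreover have "card ({j::nat. j = 0 \<and> P 0} \<union> Suc ` {j. j < n \<and> P (Suc j)})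
      = card {j::nat. j = 0 \<and> P 0} + card (Suc ` {j. j < n \<and> P (Suc j)})"
    by (rule card_Un_disjoint) auto
  moreover have "card {j::nat. j = 0 \<and> P 0} = (if P 0 then 1 else 0)" by simp
  ultimately show ?thesis by (simp only: card_image[OF inj_Suc])
qed

text \<open>Removing the first vertex lowers exactly one of the two arrow counts, according to the
  kind of the first arrow. Here k is just the number of dashed arrows; nothing ties it to m
  yet.\<close>

lemma Cons_in_weingarten_paths:
  assumes "l + k \<ge> 1"
  shows "x # q \<in> weingarten_paths k m l \<longleftrightarrow> x = m \<and>
    (solid_arrow m (q ! 0) \<and> l \<ge> 1 \<and> q \<in> weingarten_paths k (q ! 0) (l - 1) \<or>
     dashed_arrow m (q ! 0) \<and> k \<ge> 1 \<and> q \<in> weingarten_paths (k - 1) (q ! 0) l)"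
proof -
  obtain n where n: "l + k = Suc n" using assms by (cases "l + k") auto
  have n1: "l \<ge> 1 \<Longrightarrow> l - 1 + k = n" and n2: "k \<ge> 1 \<Longrightarrow> l + (k - 1) = n"
    using n by auto
  have all: "(\<forall>j<Suc n. solid_arrow ((x # q) ! j) ((x # q) ! Suc j) \<or>
      dashed_arrow ((x # q) ! j) ((x # q) ! Suc j)) \<longleftrightarrow>
    (solid_arrow x (q ! 0) \<or> dashed_arrow x (q ! 0)) \<and>
    (\<forall>j<n. solid_arrow (q ! j) (q ! Suc j) \<or> dashed_arrow (q ! j) (q ! Suc j))"
    by (simp add: All_less_Suc2)
  show ?thesis
    unfolding weingarten_paths_def mem_Collect_eq n all card_less_Suc_shift
    using not_solid_and_dashed[of m "q ! 0"] n
    by (auto simp: n1 n2)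
qed

lemma weingarten_paths_0: "weingarten_paths 0 {} l = (if l = 0 then {[{}]} else {})"
proof (cases l)
  case 0
  then show ?thesis
    by (auto simp: weingarten_paths_def length_Suc_conv)
next
  case (Suc n)
  have "\<not> solid_arrow {} m'" "\<not> dashed_arrow {} m'" for m'
    using solid_arrow_iff[of "{}" 0] dashed_arrow_iff[of "{}" 0] by (auto simp: pair_partitions_0)
  then show ?thesis using Suc
    by (auto simp: weingarten_paths_def)
qed

lemma weingarten_paths_eq:
  assumes m: "m \<in> pair_partitions k" and k: "k \<ge> 1"
  shows "weingarten_paths k m l =
    (\<Union>i\<in>{1..<2 * k - 1}. if l = 0 then {} else (#) m ` weingarten_paths k (swap_last k i m) (l - 1)) \<union>
    (if {2 * k - 1, 2 * k} \<in> m
     then (#) m ` weingarten_paths (k - 1) (m - {{2 * k - 1, 2 * k}}) l else {})"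
    (is "_ = ?R")
proof (intro set_eqI)
  fix p
  have hd: "q ! 0 = m'" if "q \<in> weingarten_paths k' m' l'" for q k' m' l'
    using that by (simp add: weingarten_paths_def)
  have C: "x # q \<in> weingarten_paths k m l \<longleftrightarrow> x # q \<in> ?R" for x q
  proof -
    let ?b = "{2 * k - 1, 2 * k}"
    have e2: "q \<in> weingarten_paths k' m' l' \<longleftrightarrow> q ! 0 = m' \<and> q \<in> weingarten_paths k' (q ! 0) l'"
      for k' m' l'
      by (metis hd)
    have e1: "(\<exists>i\<in>I. l \<ge> 1 \<and> q \<in> weingarten_paths k (f i) (l - 1)) \<longleftrightarrow>
        (\<exists>i\<in>I. q ! 0 = f i) \<and> l \<ge> 1 \<and> q \<in> weingarten_paths k (q ! 0) (l - 1)"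
      for I :: "nat set" and f
    proof -
      have "q \<in> weingarten_paths k (f i) (l - 1) \<longleftrightarrow>
          q ! 0 = f i \<and> q \<in> weingarten_paths k (q ! 0) (l - 1)" for i
        by (rule e2)
      then show ?thesis by blast
    qed
    have e3: "q \<in> weingarten_paths (k - 1) (m - {?b}) l \<longleftrightarrow>
        q ! 0 = m - {?b} \<and> q \<in> weingarten_paths (k - 1) (q ! 0) l"
      by (rule e2)
    have "x # q \<in> ?R \<longleftrightarrow> x = m \<and>
      ((\<exists>i\<in>{1..<2 * k - 1}. l \<ge> 1 \<and> q \<in> weingarten_paths k (swap_last k i m) (l - 1)) \<or>
       ?b \<in> m \<and> q \<in> weingarten_paths (k - 1) (m - {?b}) l)"
      by (cases "l = 0"; cases "?b \<in> m"; simp; blast)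
    also have "\<dots> \<longleftrightarrow> x = m \<and>
      ((\<exists>i\<in>{1..<2 * k - 1}. q ! 0 = swap_last k i m) \<and> l \<ge> 1 \<and>
         q \<in> weingarten_paths k (q ! 0) (l - 1) \<or>
       (k \<ge> 1 \<and> ?b \<in> m \<and> q ! 0 = m - {?b}) \<and> k \<ge> 1 \<and> q \<in> weingarten_paths (k - 1) (q ! 0) l)"
      unfolding e1 using e3 k by blast
    also have "\<dots> \<longleftrightarrow> x # q \<in> weingarten_paths k m l"
      unfolding Cons_in_weingarten_paths[OF trans_le_add2[OF k]]
        solid_arrow_iff[OF m] dashed_arrow_iff[OF m] ..
    finally show ?thesis ..
  qed
  show "p \<in> weingarten_paths k m l \<longleftrightarrow> p \<in> ?R"
  proof (cases p)
    case Nil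
    then show ?thesis by (auto simp: weingarten_paths_def split: if_splits)
  next
    case (Cons x q)
    then show ?thesis using C by simp
  qed
qed

lemma finite_weingarten_paths:
  "m \<in> pair_partitions k \<Longrightarrow> finite (weingarten_paths k m l)"
\<comment> \<open>A solid arrow lowers l and a dashed one lowers k, so their sum decreases along
  every arrow.\<close>
proof (induction "k + l" arbitrary: k l m)
  case 0
  then show ?case by (auto simp: pair_partitions_0 weingarten_paths_0)
next
  case (Suc n)
  show ?case
  proof (cases "k = 0")
    case True
    then show ?thesis using Suc.prems by (auto simp: pair_partitions_0 weingarten_paths_0)
  next
    case False
    then have k: "k \<ge> 1" by simp
    have "finite (weingarten_paths k (swap_last k i m) (l - 1))"
      if "i \<in> {1..<2 * k - 1}" "l \<noteq> 0" for i
      using that Suc.hyps swap_last_in_pair_partitions[OF Suc.prems that(1)] by auto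
    moreover have "finite (weingarten_paths (k - 1) (m - {{2 * k - 1, 2 * k}}) l)"
      if "{2 * k - 1, 2 * k} \<in> m"
      using that k Suc.hyps remove_last_in_pair_partitions[OF Suc.prems k that] by auto
    ultimately show ?thesis
      unfolding weingarten_paths_eq[OF Suc.prems k] by auto
  qed
qed

text \<open>Different arrows out of m have different targets: the swaps by
  \<open>inj_on_swap_last\<close>, the dashed arrow because its target lies in
  \<open>pair_partitions (k - 1)\<close>. The union in \<open>weingarten_paths_eq\<close> is
  therefore disjoint, and cardinalities add up.\<close>

lemma card_weingarten_paths:
  assumes m: "m \<in> pair_partitions k" and k: "k \<ge> 1"
  shows "card (weingarten_paths k m l) =
    (\<Sum>i\<in>{1..<2 * k - 1}. if l = 0 then 0 else card (weingarten_paths k (swap_last k i m) (l - 1))) +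
    (if {2 * k - 1, 2 * k} \<in> m
     then card (weingarten_paths (k - 1) (m - {{2 * k - 1, 2 * k}}) l) else 0)"
proof -
  let ?S = "\<lambda>i. if l = 0 then {} else (#) m ` weingarten_paths k (swap_last k i m) (l - 1)"
  let ?D = "if {2 * k - 1, 2 * k} \<in> m
     then (#) m ` weingarten_paths (k - 1) (m - {{2 * k - 1, 2 * k}}) l else {}"
  have disj: "(#) m ` weingarten_paths k1 m1 l1 \<inter> (#) m ` weingarten_paths k2 m2 l2 = {}"
    if "m1 \<noteq> m2" for k1 m1 l1 k2 m2 l2
    using that by (auto simp: weingarten_paths_def)
  have fS: "finite (?S i)" if "i \<in> {1..<2 * k - 1}" for i
    using finite_weingarten_paths[OF swap_last_in_pair_partitions[OF m that]] by auto
  have fD: "finite ?D"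
    using finite_weingarten_paths[OF remove_last_in_pair_partitions[OF m k]] by auto
  have "?S i \<inter> ?D = {}" if "i \<in> {1..<2 * k - 1}" for i
  proof -
    have "swap_last k i m \<noteq> m - {{2 * k - 1, 2 * k}}" if "{2 * k - 1, 2 * k} \<in> m"
      using pair_partitions_unique[OF remove_last_in_pair_partitions[OF m k that]]
        swap_last_in_pair_partitions[OF m \<open>i \<in> _\<close>] k by (metis diff_less not_one_le_zero less_irrefl zero_less_one not_gr_zero)
    then show ?thesis using disj by (cases "l = 0") auto
  qed
  then have SD: "(\<Union>i\<in>{1..<2 * k - 1}. ?S i) \<inter> ?D = {}" by blast
  have SS: "?S i \<inter> ?S j = {}" if "i \<in> {1..<2 * k - 1}" "j \<in> {1..<2 * k - 1}" "i \<noteq> j" for i j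
  proof -
    have "swap_last k i m \<noteq> swap_last k j m"
      using inj_onD[OF inj_on_swap_last[OF m] _ that(1,2)] that(3) by blast
    from disj[OF this] show ?thesis by simp
  qed
  have "card (weingarten_paths k m l) = card (\<Union>i\<in>{1..<2 * k - 1}. ?S i) + card ?D"
    unfolding weingarten_paths_eq[OF m k] using fS fD SD by (intro card_Un_disjoint) blast+
  also have "card (\<Union>i\<in>{1..<2 * k - 1}. ?S i) = (\<Sum>i\<in>{1..<2 * k - 1}. card (?S i))"
    using fS SS by (intro card_UN_disjoint) blast+
  also have "\<dots> = (\<Sum>i\<in>{1..<2 * k - 1}. if l = 0 then 0 else card (weingarten_paths k (swap_last k i m) (l - 1)))"
    by (intro sum.cong) (auto simp: card_image)
  also have "card ?D = (if {2 * k - 1, 2 * k} \<in> m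
     then card (weingarten_paths (k - 1) (m - {{2 * k - 1, 2 * k}}) l) else 0)"
    by (auto simp: card_image)
  finally show ?thesis .
qed

section \<open>The lower bound\<close>

lemma card_weingarten_paths_add_two:
  assumes m: "m \<in> pair_partitions k" and k: "k \<ge> 1"
  shows "(2 * k - 2) * card (weingarten_paths k m l) \<le> card (weingarten_paths k m (l + 2))"
proof -
  have "card (weingarten_paths k m l) \<le> card (weingarten_paths k (swap_last k i m) (l + 1))"
    if i: "i \<in> {1..<2 * k - 1}" for i
  proof -
    have "card (weingarten_paths k m l)
        = card (weingarten_paths k (swap_last k i (swap_last k i m)) l)"
      by (simp add: perm_act_transpose_twice)
    \<comment> \<open>Of all continuations only the arrow j = i, which leads back to m, is
      kept.\<close>
    also have "\<dots> \<le> (\<Sum>j\<in>{1..<2 * k - 1}. card (weingarten_paths k (swap_last k j (swap_last k i m)) l))"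
      by (rule member_le_sum) (use i in auto)
    also have "\<dots> \<le> card (weingarten_paths k (swap_last k i m) (l + 1))"
      using card_weingarten_paths[OF swap_last_in_pair_partitions[OF m i] k, of "l + 1"] by simp
    finally show ?thesis .
  qed
  then have "(\<Sum>i\<in>{1..<2 * k - 1}. card (weingarten_paths k m l))
      \<le> (\<Sum>i\<in>{1..<2 * k - 1}. card (weingarten_paths k (swap_last k i m) (l + 1)))"
    by (intro sum_mono)
  also have "\<dots> \<le> card (weingarten_paths k m (l + 2))"
    using card_weingarten_paths[OF m k, of "l + 2"] by simp
  finally show ?thesis by (simp add: numeral_2_eq_2)
qed

lemma card_weingarten_paths_add_even:
  assumes m: "m \<in> pair_partitions k" and k: "k \<ge> 1"
  shows "(2 * k - 2) ^ g * card (weingarten_paths k m l) \<le> card (weingarten_paths k m (l + 2 * g))"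
proof (induction g)
  case (Suc g)
  have "(2 * k - 2) ^ Suc g * card (weingarten_paths k m l)
      \<le> (2 * k - 2) * card (weingarten_paths k m (l + 2 * g))"
    using mult_le_mono2[OF Suc.IH, of "2 * k - 2"] by (simp add: mult.assoc)
  also have "\<dots> \<le> card (weingarten_paths k m (l + 2 * g + 2))"
    by (rule card_weingarten_paths_add_two[OF m k])
  finally show ?case by simp
qed simp

subsection \<open>Components as alternating cycles\<close>

text \<open>The partner map of \<open>id_pairing k\<close>, chosen independently of k. Its only
  fixed point is 0, by truncated subtraction.\<close>

definition mate :: "nat \<Rightarrow> nat" where
  "mate x = (if odd x then x + 1 else x - 1)"

lemma mate_mate [simp]: "x \<ge> 1 \<Longrightarrow> mate (mate x) = x"
  by (auto simp: mate_def)

lemma mate_neq [simp]: "x \<ge> 1 \<Longrightarrow> mate x \<noteq> x"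
  by (auto simp: mate_def)

lemma mate_in [simp]: "x \<in> {1..2 * k} \<Longrightarrow> mate x \<in> {1..2 * k}"
  unfolding mate_def atLeastAtMost_iff by presburger

lemma inj_on_mate: "inj_on mate {1..}"
  by (rule inj_on_inverseI[of _ mate]) simp

lemma in_id_pairing_iff: "{x, y} \<in> id_pairing k \<longleftrightarrow> x \<in> {1..2 * k} \<and> y = mate x"
proof
  assume "{x, y} \<in> id_pairing k"
  then obtain i where i: "i \<in> {1..k}" "{x, y} = {2 * i - 1, 2 * i}"
    by (auto simp: id_pairing_def)
  then have "x = 2 * i - 1 \<and> y = 2 * i \<or> x = 2 * i \<and> y = 2 * i - 1"
    by (simp add: doubleton_eq_iff)
  then show "x \<in> {1..2 * k} \<and> y = mate x"
    using i(1) by (auto simp: mate_def)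
next
  assume x: "x \<in> {1..2 * k} \<and> y = mate x"
  show "{x, y} \<in> id_pairing k"
  proof (cases "odd x")
    case True
    then obtain j where "x = 2 * j + 1" by (elim oddE)
    then have "{x, y} = {2 * Suc j - 1, 2 * Suc j}" "Suc j \<in> {1..k}"
      using x by (auto simp: mate_def)
    then show ?thesis unfolding id_pairing_def by blast
  next
    case False
    then obtain j where "x = 2 * j" by (auto elim: evenE)
    then have "{x, y} = {2 * j - 1, 2 * j}" "j \<in> {1..k}"
      using x by (auto simp: mate_def insert_commute)
    then show ?thesis unfolding id_pairing_def by blast
  qed
qed

text \<open>A component of the graph is a cycle alternating between blocks of \<open>id_pairing k\<close> and of \<open>m\<close>.
  It is recorded by the list of the first endpoints, along the cycle, of its edges in \<open>id_pairing k\<close>.\<close>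

definition alternating_cycle :: "nat set set \<Rightarrow> nat list \<Rightarrow> bool" where
  "alternating_cycle m ys \<longleftrightarrow> ys \<noteq> [] \<and> successively (\<lambda>x y. {mate x, y} \<in> m) ys \<and>
     {mate (last ys), hd ys} \<in> m"

text \<open>The vertex set of the component recorded by \<open>ys\<close>, which lists only one
  endpoint of each edge of \<open>id_pairing k\<close>.\<close>

definition mate_closure :: "nat list \<Rightarrow> nat set" where
  "mate_closure ys = set ys \<union> mate ` set ys"

lemma alternating_cycle_next:
  assumes "alternating_cycle m ys" "z \<in> set ys"
  obtains y where "y \<in> set ys" "{mate z, y} \<in> m"
proof -
  obtain as bs where ys: "ys = as @ z # bs" using assms(2) by (auto simp: in_set_conv_decomp)
  show ?thesis
  proof (cases bs)
    case Nil
    then show ?thesis using assms(1) that[of "hd ys"] unfolding alternating_cycle_def ys by (cases as) auto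
  next
    case (Cons b bs')
    then show ?thesis using assms(1) that[of b] unfolding alternating_cycle_def ys
      by (simp add: successively_append_iff)
  qed
qed

lemma alternating_cycle_prev:
  assumes "alternating_cycle m ys" "z \<in> set ys"
  obtains y where "y \<in> set ys" "{mate y, z} \<in> m"
proof -
  obtain as bs where ys: "ys = as @ z # bs" using assms(2) by (auto simp: in_set_conv_decomp)
  show ?thesis
  proof (cases "as = []")
    case True
    then show ?thesis using assms(1) that[of "last ys"] unfolding alternating_cycle_def ys by simp
  next
    case False
    then show ?thesis using assms(1) that[of "last as"] unfolding alternating_cycle_def ys
      by (simp add: successively_append_iff)
  qed
qed

lemma alternating_cycle_subset:
  assumes m: "m \<in> pair_partitions k" and c: "alternating_cycle m ys"
  shows "set ys \<subseteq> {1..2 * k}" "mate_closure ys \<subseteq> {1..2 * k}"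
proof -
  show "set ys \<subseteq> {1..2 * k}"
  proof
    fix z assume "z \<in> set ys"
    then obtain y where "{mate y, z} \<in> m" using alternating_cycle_prev[OF c] by blast
    then show "z \<in> {1..2 * k}" using pair_mem[OF m] by blast
  qed
  then show "mate_closure ys \<subseteq> {1..2 * k}"
    unfolding mate_closure_def using mate_in by blast
qed

lemma successively_rtrancl:
  assumes "successively P ys" "\<And>x y. P x y \<Longrightarrow> (x, y) \<in> R\<^sup>*" "y \<in> set ys"
  shows "(hd ys, y) \<in> R\<^sup>*"
  using assms(1,3)
proof (induction ys arbitrary: y)
  case (Cons x ys)
  show ?case
  proof (cases "y = x")
    case False
    then have y: "y \<in> set ys" "ys \<noteq> []" using Cons.prems by auto
    then have "P x (hd ys)" "successively P ys"
      using Cons.prems(1) by (auto simp: successively_Cons)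
    then show ?thesis using Cons.IH[OF _ y(1)] assms(2) by (metis list.sel(1) rtrancl_trans)
  qed simp
qed simp

text \<open>A vertex has only one neighbour in each of the two pairings, and for a vertex of the
  cycle both lie on the cycle; so no edge leaves it. Conversely, the head of the list reaches every
  vertex by walking along the list.\<close>

lemma component_eq_mate_closure:
  assumes m: "m \<in> pair_partitions k" and c: "alternating_cycle m ys" and x: "x \<in> mate_closure ys"
  shows "(pairing_adj k m)\<^sup>* `` {x} = mate_closure ys"
proof
  let ?R = "pairing_adj k m"
  have sub: "set ys \<subseteq> {1..2 * k}" by (rule alternating_cycle_subset[OF m c])
  have step: "w \<in> mate_closure ys" if z: "z \<in> mate_closure ys" and zw: "(z, w) \<in> ?R" for z w
  proof -
    consider "z \<in> {1..2 * k}" "w = mate z" | "{z, w} \<in> m"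
      using zw in_id_pairing_iff[of z w k] unfolding pairing_adj_def by blast
    then show ?thesis
    proof cases
      case 1
      then show ?thesis using z sub unfolding mate_closure_def by auto
    next
      case 2
      consider "z \<in> set ys" | u where "u \<in> set ys" "z = mate u"
        using z unfolding mate_closure_def by blast
      then show ?thesis
      proof cases
        case 1
        then obtain y where y: "y \<in> set ys" "{mate y, z} \<in> m" using alternating_cycle_prev[OF c] by blast
        then have "w = mate y"
          using pair_unique[OF m 2] by (simp add: insert_commute)
        then show ?thesis using y by (simp add: mate_closure_def)
      next
        case (2 u)
        then obtain y where y: "y \<in> set ys" "{mate u, y} \<in> m" using alternating_cycle_next[OF c] by blast
        then have "w = y" using pair_unique[OF m \<open>{z, w} \<in> m\<close>] 2 by simp
        then show ?thesis using y by (simp add: mate_closure_def)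
      qed
    qed
  qed
  show "?R\<^sup>* `` {x} \<subseteq> mate_closure ys"
  proof
    fix y assume "y \<in> ?R\<^sup>* `` {x}"
    then have "(x, y) \<in> ?R\<^sup>*" by simp
    then show "y \<in> mate_closure ys" by (induction rule: rtrancl_induct) (use x step in blast)+
  qed
  have mate: "(y, mate y) \<in> ?R\<^sup>*" if "y \<in> {1..2 * k}" for y
    using that by (auto simp: pairing_adj_def in_id_pairing_iff)
  have P: "(u, w) \<in> ?R\<^sup>*" if "{mate u, w} \<in> m" for u w
  proof -
    have "mate u \<in> {1..2 * k}" using pair_mem[OF m that] by blast
    then have "u \<in> {1..2 * k}" unfolding mate_def atLeastAtMost_iff by presburger
    moreover have "(mate u, w) \<in> ?R" using that by (simp add: pairing_adj_def)
    ultimately show ?thesis using mate by (meson rtrancl.rtrancl_into_rtrancl)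
  qed
  have hd: "(hd ys, y) \<in> ?R\<^sup>*" if y: "y \<in> mate_closure ys" for y
  proof -
    have *: "(hd ys, z) \<in> ?R\<^sup>*" if "z \<in> set ys" for z
      using successively_rtrancl[of "\<lambda>x y. {mate x, y} \<in> m" ys ?R z] c that P
      by (simp add: alternating_cycle_def)
    consider "y \<in> set ys" | z where "z \<in> set ys" "y = mate z"
      using y unfolding mate_closure_def by blast
    then show ?thesis
    proof cases
      case (2 z)
      then show ?thesis using *[of z] mate[of z] sub by (auto intro: rtrancl_trans)
    qed (rule *)
  qed
  have "sym ?R" by (auto simp: sym_def pairing_adj_def insert_commute)
  then have "sym (?R\<^sup>*)" by (rule sym_rtrancl)
  then have "(x, hd ys) \<in> ?R\<^sup>*" using hd[OF x] by (auto dest: symD)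
  then show "mate_closure ys \<subseteq> ?R\<^sup>* `` {x}"
    using hd by (auto intro: rtrancl_trans)
qed

text \<open>The means of finding the components after an arrow: every alternating cycle fills a
  whole component, so exhibiting cycles that cover all points is enough.\<close>

lemma pairing_components_eqI:
  assumes m: "m \<in> pair_partitions k"
    and cyc: "\<And>C. C \<in> P \<Longrightarrow> \<exists>ys. alternating_cycle m ys \<and> C = mate_closure ys"
    and cover: "{1..2 * k} \<subseteq> \<Union>P"
  shows "pairing_components k m = P"
proof
  have *: "(pairing_adj k m)\<^sup>* `` {x} = C" if "x \<in> C" "C \<in> P" for x C
    using component_eq_mate_closure[OF m] cyc that by blast
  show "pairing_components k m \<subseteq> P"
  proof
    fix D assume "D \<in> pairing_components k m"
    then obtain x where x: "x \<in> {1..2 * k}" "D = (pairing_adj k m)\<^sup>* `` {x}"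
      unfolding pairing_components_def by blast
    then obtain C where "x \<in> C" "C \<in> P" using cover by blast
    then show "D \<in> P" using * x by blast
  qed
  show "P \<subseteq> pairing_components k m"
  proof
    fix C assume C: "C \<in> P"
    then obtain ys where ys: "alternating_cycle m ys" "C = mate_closure ys" using cyc by blast
    then have "hd ys \<in> C" by (simp add: mate_closure_def alternating_cycle_def)
    moreover have "hd ys \<in> {1..2 * k}"
      using alternating_cycle_subset[OF m ys(1)] ys calculation by blast
    ultimately show "C \<in> pairing_components k m"
      using *[OF _ C] unfolding pairing_components_def by blast
  qed
qed

text \<open>Writing \<open>e\<close> for the map \<open>mate\<close> and \<open>f\<close> for the partner map of \<open>m\<close>, the cycle of \<open>f \<circ> e\<close> through \<open>x\<close>
  avoids \<open>e x\<close>: conjugation by \<open>e\<close> inverts \<open>f \<circ> e\<close>, so \<open>e x = (f \<circ> e)\<^sup>n x\<close> would yield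
  a fixed point of \<open>e\<close> or \<open>f\<close> in the middle.\<close>

lemma ex_alternating_cycle:
  assumes m: "m \<in> pair_partitions k" and x: "x \<in> {1..2 * k}"
  obtains ys where "alternating_cycle m ys" "hd ys = x" "distinct ys" "set ys \<inter> mate ` set ys = {}"
proof -
  define f where "f x = (THE y. {x, y} \<in> m)" for x
  have f: "{x, f x} \<in> m" if x: "x \<in> {1..2 * k}" for x
  proof -
    obtain y where y: "{x, y} \<in> m" using ex_partner[OF m x] by blast
    then have "f x = y"
      unfolding f_def by (rule the_equality) (rule pair_unique[OF m _ y])
    with y show ?thesis by simp
  qed
  have f_eq: "f x = y" if "{x, y} \<in> m" for x y
    using pair_unique[OF m f[OF pair_mem(1)[OF m that]] that] .
  have f_in: "f x \<in> {1..2 * k}" if "x \<in> {1..2 * k}" for x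
    using pair_mem(2)[OF m f[OF that]] .
  have ff: "f (f x) = x" if "x \<in> {1..2 * k}" for x
    by (rule f_eq) (use f[OF that] in \<open>simp add: insert_commute\<close>)
  have f_neq: "f x \<noteq> x" if "x \<in> {1..2 * k}" for x
    using pair_distinct[OF m f[OF that]] by simp
  \<comment> \<open>The map f o mate, extended by the identity so that it is a permutation and its
    cycles are available.\<close>
  define p where "p x = (if x \<in> {1..2 * k} then f (mate x) else x)" for x
  have p_in: "p x \<in> {1..2 * k}" if "x \<in> {1..2 * k}" for x
    using that f_in[OF mate_in[OF that]] by (simp add: p_def)
  have mate_p: "mate (p x) \<in> {1..2 * k}" if "x \<in> {1..2 * k}" for x
    by (rule mate_in[OF p_in[OF that]])
  \<comment> \<open>This is the statement that conjugation by \<open>mate\<close> inverts p.\<close>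
  have p_mate_p: "p (mate (p x)) = mate x" if "x \<in> {1..2 * k}" for x
  proof -
    have "p (mate (p x)) = f (p x)" using p_in[OF that] mate_p[OF that] by (simp add: p_def)
    also have "\<dots> = mate x" using that ff[OF mate_in[OF that]] by (simp add: p_def)
    finally show ?thesis .
  qed
  have inj: "inj_on p {1..2 * k}"
  proof (rule inj_onI)
    fix x y assume x: "x \<in> {1..2 * k}" and y: "y \<in> {1..2 * k}" and "p x = p y"
    then have "mate x = mate y" using p_mate_p[OF x] p_mate_p[OF y] by simp
    then have "mate (mate x) = mate (mate y)" by simp
    then show "x = y" using x y by simp
  qed
  have "p permutes {1..2 * k}"
  proof (rule bij_imp_permutes)
    have "p ` {1..2 * k} = {1..2 * k}"
      by (rule endo_inj_surj) (use inj p_in in auto)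
    then show "bij_betw p {1..2 * k} {1..2 * k}" using inj by (simp add: bij_betw_def)
  qed (auto simp: p_def)
  then have perm: "permutation p" by (auto simp: permutation_permutes)
  have pow_in: "(p ^^ n) z \<in> {1..2 * k}" if "z \<in> {1..2 * k}" for n z
    by (induction n) (simp_all only: funpow.simps id_apply o_apply that p_in)
  \<comment> \<open>Descent by two: cancelling one p at either end turns
    \<open>(p ^^ (r + 2)) z = mate z\<close> into \<open>(p ^^ r) (p z) = mate (p z)\<close>. It
    ends at a fixed point of \<open>mate\<close> for n = 0, or of f for n = 1.\<close>
  have no_mate: "(p ^^ n) z \<noteq> mate z" if "z \<in> {1..2 * k}" for n z
    using that
  proof (induction n arbitrary: z rule: less_induct)
    case (less n)
    consider "n = 0" | "n = 1" | r where "n = Suc (Suc r)"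
      by (metis One_nat_def not0_implies_Suc)
    then show ?case
    proof cases
      case 1
      then show ?thesis using less.prems mate_neq[of z, symmetric] by simp
    next
      case 2
      then show ?thesis using f_neq[OF mate_in[OF less.prems]] less.prems
        by (simp add: p_def del: atLeastAtMost_iff)
    next
      case (3 r)
      show ?thesis
      proof
        assume "(p ^^ n) z = mate z"
        then have "p ((p ^^ r) (p z)) = p (mate (p z))"
          using 3 p_mate_p[OF less.prems] by (simp add: funpow_swap1)
        then have "(p ^^ r) (p z) = mate (p z)"
          using inj_onD[OF inj] pow_in[OF p_in[OF less.prems]] mate_p[OF less.prems] by blast
        then show False using less.IH[of r "p z"] 3 p_in[OF less.prems] by simp
      qed
    qed
  qed
  define N where "N = least_power p x"
  define ys where "ys = map (\<lambda>i. (p ^^ i) x) [0..<N]"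
  have N: "(p ^^ N) x = x" "N > 0"
    unfolding N_def using least_power_of_permutation[OF perm] by auto
  have "distinct ys" unfolding ys_def N_def by (rule cycle_of_permutation[OF perm])
  moreover have "hd ys = x" using N by (simp add: ys_def upt_rec)
  moreover have p_block: "{mate z, p z} \<in> m" if "z \<in> {1..2 * k}" for z
    using f[OF mate_in[OF that]] that by (simp add: p_def)
  have "alternating_cycle m ys"
    unfolding alternating_cycle_def
  proof (intro conjI)
    show "ys \<noteq> []" using N by (simp add: ys_def)
    show "successively (\<lambda>x y. {mate x, y} \<in> m) ys"
      using p_block[OF pow_in[OF x]] by (simp add: successively_conv_nth ys_def)
    obtain n where n: "N = Suc n" using N(2) by (cases N) auto
    then show "{mate (last ys), hd ys} \<in> m"
      using p_block[OF pow_in[OF x, of n]] N(1) \<open>hd ys = x\<close> by (simp add: ys_def)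
  qed
  moreover have "set ys \<inter> mate ` set ys = {}"
  proof -
    have "(p ^^ s) x \<noteq> mate ((p ^^ t) x)" for s t
    proof (cases "t \<le> s")
      case True
      then have "(p ^^ s) x = (p ^^ (s - t)) ((p ^^ t) x)"
        using fun_cong[OF funpow_add[of "s - t" t p], of x] by simp
      then show ?thesis using no_mate[OF pow_in[OF x]] by simp
    next
      case False
      then have "(p ^^ t) x = (p ^^ (t - s)) ((p ^^ s) x)"
        using fun_cong[OF funpow_add[of "t - s" s p], of x] by simp
      then have "(p ^^ t) x \<noteq> mate ((p ^^ s) x)" using no_mate[OF pow_in[OF x]] by simp
      then show ?thesis using mate_mate[of "(p ^^ t) x"] pow_in[OF x, of t] by auto
    qed
    then show ?thesis by (auto simp: ys_def)
  qed
  ultimately show ?thesis using that by blast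
qed

subsection \<open>Swaps acting on alternating cycles\<close>

text \<open>Blocks that contain neither i nor j are unaffected. The head of the list is never the
  second element of a block in question, so it may be i or j itself; hence \<open>tl\<close> in the
  second assumption.\<close>

lemma successively_swap:
  assumes "\<And>x. x \<in> set zs \<Longrightarrow> mate x \<notin> {i, j}" "\<And>y. y \<in> set (tl zs) \<Longrightarrow> y \<notin> {i, j}"
  shows "successively (\<lambda>x y. {mate x, y} \<in> perm_act (transpose i j) m) zs \<longleftrightarrow>
    successively (\<lambda>x y. {mate x, y} \<in> m) zs"
  using assms
proof (induction zs)
  case (Cons x zs)
  show ?case
  proof (cases "zs = []")
    case False
    then have "hd zs \<in> set (tl (x # zs))" by simp
    then have "hd zs \<notin> {i, j}" "mate x \<notin> {i, j}" using Cons.prems by force+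
    then have "{mate x, hd zs} \<in> perm_act (transpose i j) m \<longleftrightarrow> {mate x, hd zs} \<in> m"
      by (simp add: doubleton_in_perm_act_transpose)
    moreover have "y \<notin> {i, j}" if "y \<in> set (tl zs)" for y
      using that Cons.prems(2)[of y] by (simp add: list.set_sel(2) False)
    ultimately show ?thesis using Cons.IH Cons.prems(1) by (auto simp: successively_Cons)
  qed simp
qed simp

lemma alternating_cycle_swap_unchanged:
  assumes "alternating_cycle m zs" "i \<notin> mate_closure zs" "j \<notin> mate_closure zs"
  shows "alternating_cycle (perm_act (transpose i j) m) zs"
proof -
  have a: "mate x \<notin> {i, j}" "x \<notin> {i, j}" if "x \<in> set zs" for x
    using that assms(2,3) unfolding mate_closure_def by blast+
  have ne: "zs \<noteq> []" using assms(1) by (simp add: alternating_cycle_def)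
  have "successively (\<lambda>x y. {mate x, y} \<in> perm_act (transpose i j) m) zs"
    using assms(1) a by (subst successively_swap) (auto simp: alternating_cycle_def dest: list.set_sel(2)[OF ne])
  moreover have "{mate (last zs), hd zs} \<in> perm_act (transpose i j) m"
    using a[of "last zs"] a[of "hd zs"] ne assms(1)
    by (simp add: doubleton_in_perm_act_transpose alternating_cycle_def)
  ultimately show ?thesis using ne by (simp add: alternating_cycle_def)
qed

text \<open>The swap exchanges the blocks that enter the two lists at their heads:
  \<open>mate (last xs)\<close> leads to i before and to j after, and \<open>mate (last zs)\<close>
  the other way round. Read from left to right this splits a cycle; applied to the swapped pairing
  and read backwards, it merges two.\<close>

lemma alternating_cycle_append_iff_swap:
  assumes ne: "xs \<noteq> []" "zs \<noteq> []" and hd: "hd xs = j" "hd zs = i"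
    and mate: "\<And>x. x \<in> set xs \<union> set zs \<Longrightarrow> mate x \<notin> {i, j}"
    and tl: "\<And>y. y \<in> set (tl xs) \<union> set (tl zs) \<Longrightarrow> y \<notin> {i, j}"
  shows "alternating_cycle m (xs @ zs) \<longleftrightarrow>
    alternating_cycle (perm_act (transpose i j) m) xs \<and> alternating_cycle (perm_act (transpose i j) m) zs"
proof -
  have "successively (\<lambda>x y. {mate x, y} \<in> perm_act (transpose i j) m) xs \<longleftrightarrow>
      successively (\<lambda>x y. {mate x, y} \<in> m) xs"
    "successively (\<lambda>x y. {mate x, y} \<in> perm_act (transpose i j) m) zs \<longleftrightarrow>
      successively (\<lambda>x y. {mate x, y} \<in> m) zs"
    using mate tl by (intro successively_swap; blast)+
  moreover have "{mate (last xs), j} \<in> perm_act (transpose i j) m \<longleftrightarrow> {mate (last xs), i} \<in> m"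
    "{mate (last zs), i} \<in> perm_act (transpose i j) m \<longleftrightarrow> {mate (last zs), j} \<in> m"
    using mate[of "last xs"] mate[of "last zs"] ne by (simp_all add: doubleton_in_perm_act_transpose)
  ultimately show ?thesis using ne hd
    by (auto simp: alternating_cycle_def successively_append_iff)
qed

text \<open>Here the swap cuts the cycle in two paths and glues them back with the second one reversed.\<close>

lemma alternating_cycle_reverse_tail:
  assumes m: "m \<in> pair_partitions k" and ys: "alternating_cycle m (xs @ zs)" "xs \<noteq> []"
    and dist: "distinct (xs @ zs)" "set (xs @ zs) \<inter> mate ` set (xs @ zs) = {}"
    and j: "hd xs = j" and i: "mate (last xs) = i"
  shows "alternating_cycle (perm_act (transpose i j) m) (xs @ map mate (rev zs))"
proof -
  let ?m = "perm_act (transpose i j) m"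
  have pos: "x \<ge> 1" if "x \<in> set (xs @ zs)" for x
    using alternating_cycle_subset(1)[OF m ys(1)] that by auto
  have lx: "last xs \<in> set xs" "hd xs \<in> set xs" using ys(2) by auto
  have inj: "x = last xs" if "x \<in> set (xs @ zs)" "mate x = i" for x
    using that inj_onD[OF inj_on_mate, of x "last xs"] pos[OF that(1)] pos[of "last xs"] lx(1) i
    by auto
  have nm: "mate x \<noteq> y" if "x \<in> set (xs @ zs)" "y \<in> set (xs @ zs)" for x y
    using that dist(2) by (metis disjoint_iff imageI)
  have mate_j: "mate x \<noteq> j" if "x \<in> set (xs @ zs)" for x
    using nm[OF that, of "hd xs"] lx(2) j by simp
  have x_i: "x \<noteq> i" if "x \<in> set (xs @ zs)" for x
    using nm[OF _ that, of "last xs"] lx(1) i by simp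
  have tl_j: "x \<noteq> j" if "x \<in> set (tl xs) \<union> set zs" for x
    using that dist(1) ys(2) j by (cases xs) auto
  have s: "successively (\<lambda>x y. {mate x, y} \<in> m) xs" "successively (\<lambda>x y. {mate x, y} \<in> m) zs"
    using ys by (auto simp: alternating_cycle_def successively_append_iff)
  have sx: "successively (\<lambda>x y. {mate x, y} \<in> ?m) xs"
  proof -
    \<comment> \<open>The last entry is treated apart, since its mate is i and
      \<open>successively_swap\<close> would exclude it.\<close>
    obtain us w where xs: "xs = us @ [w]" using ys(2) by (cases xs rule: rev_exhaust) auto
    have "successively (\<lambda>x y. {mate x, y} \<in> ?m) us \<longleftrightarrow> successively (\<lambda>x y. {mate x, y} \<in> m) us"
    proof (rule successively_swap)
      fix x assume "x \<in> set us"
      then show "mate x \<notin> {i, j}" using inj[of x] mate_j[of x] dist(1) by (auto simp: xs)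
    next
      fix y assume y: "y \<in> set (tl us)"
      then have "y \<in> set (tl xs)" unfolding xs by (cases us) auto
      then show "y \<notin> {i, j}" using x_i[of y] tl_j[of y] by (auto dest: list.set_sel(2)[OF ys(2)])
    qed
    moreover have "{mate (last us), w} \<in> ?m \<longleftrightarrow> {mate (last us), w} \<in> m" if "us \<noteq> []"
    proof -
      have l: "last us \<in> set us" using that by simp
      have "mate (last us) \<noteq> i" using inj[of "last us"] l dist(1) by (auto simp: xs)
      moreover have "mate (last us) \<noteq> j" using mate_j[of "last us"] l by (simp add: xs)
      moreover have "w \<noteq> i" "w \<noteq> j" using x_i[of w] tl_j[of w] that by (auto simp: xs)
      ultimately show ?thesis by (simp add: doubleton_in_perm_act_transpose)
    qed
    ultimately show ?thesis using s(1) by (auto simp: xs successively_append_iff)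
  qed
  have sz: "successively (\<lambda>x y. {mate x, y} \<in> ?m) (map mate (rev zs))"
  proof -
    have "successively (\<lambda>x y. {mate x, y} \<in> ?m) zs"
    proof (subst successively_swap)
      fix x assume "x \<in> set zs"
      then show "mate x \<notin> {i, j}" using inj[of x] mate_j[of x] dist(1) lx(1) by auto
    next
      fix y assume "y \<in> set (tl zs)"
      then have "y \<in> set zs" by (cases zs) auto
      then show "y \<notin> {i, j}" using x_i[of y] tl_j[of y] by auto
    qed (rule s(2))
    \<comment> \<open>Read backwards, the block leading from x to y leads from \<open>mate y\<close>
      to \<open>mate x\<close>; this is why the reversed tail lists mates.\<close>
    then have "successively (\<lambda>x y. {mate (mate y), mate x} \<in> ?m) zs"
    proof (rule successively_mono)
      fix x y assume "x \<in> set zs" "y \<in> set zs" "{mate x, y} \<in> ?m"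
      then show "{mate (mate y), mate x} \<in> ?m" using pos[of y] by (simp add: insert_commute)
    qed
    then show ?thesis by (simp add: successively_map)
  qed
  have lxz: "{mate (last xs), hd zs} \<in> m" if "zs \<noteq> []"
    using ys that by (simp add: alternating_cycle_def successively_append_iff)
  have close: "{mate (last (xs @ zs)), j} \<in> m"
    using ys j by (simp add: alternating_cycle_def)
  show ?thesis
  proof (cases "zs = []")
    \<comment> \<open>Here {i, j} is itself a block, and the swap fixes m.\<close>
    case True
    then have "{i, j} \<in> ?m" using close i by (simp add: doubleton_in_perm_act_transpose insert_commute)
    then show ?thesis using True sx ys(2) i j by (simp add: alternating_cycle_def)
  next
    case False
    have lz: "last zs \<in> set zs" "hd zs \<in> set zs" using False by auto
    have "mate (last zs) \<noteq> i" "mate (last zs) \<noteq> j"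
      using inj[of "last zs"] mate_j[of "last zs"] lz lx dist(1) by auto
    \<comment> \<open>The two new joints: i is now matched to \<open>mate (last zs)\<close>, where
      the reversed tail begins, and \<open>hd zs\<close>, where it ends, is matched to j.\<close>
    then have 1: "{i, mate (last zs)} \<in> ?m"
      using close False by (simp add: doubleton_in_perm_act_transpose insert_commute)
    have "hd zs \<noteq> i" "hd zs \<noteq> j" using x_i[of "hd zs"] tl_j[of "hd zs"] lz by auto
    then have 2: "{hd zs, j} \<in> ?m"
      using lxz[OF False] i by (simp add: doubleton_in_perm_act_transpose insert_commute)
    have "mate (mate (hd zs)) = hd zs" using pos[of "hd zs"] lz by simp
    then show ?thesis using sx sz 1 2 ys(2) i j False
      by (simp add: alternating_cycle_def successively_append_iff hd_map last_map hd_rev last_rev)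
  qed
qed

text \<open>This is W(m). That it counts the geodesics from m to the empty pairing is shown in
  \<open>card_weingarten_paths_le_norm\<close>.\<close>

definition pairing_weight :: "nat \<Rightarrow> nat set set \<Rightarrow> real" where
  "pairing_weight k m = (\<Prod>C\<in>pairing_components k m. catalan (card C div 2 - 1))"

section \<open>Components as a partition into sets of even size\<close>

lemma card_mate_closure:
  assumes "set ys \<subseteq> {1..}" "distinct ys" "set ys \<inter> mate ` set ys = {}"
  shows "card (mate_closure ys) = 2 * length ys"
proof -
  have "card (mate ` set ys) = card (set ys)"
    using assms(1) inj_on_mate by (intro card_image) (auto intro: inj_on_subset)
  then show ?thesis unfolding mate_closure_def
    by (subst card_Un_disjoint) (use assms in \<open>auto simp: distinct_card\<close>)
qed

lemma finite_pairing_components: "finite (pairing_components k m)"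
  by (simp add: pairing_components_def)

lemma mate_closure_in_pairing_components:
  assumes "m \<in> pair_partitions k" "alternating_cycle m ys"
  shows "mate_closure ys \<in> pairing_components k m"
proof -
  have h: "hd ys \<in> mate_closure ys" using assms(2) by (simp add: alternating_cycle_def mate_closure_def)
  then have "hd ys \<in> {1..2 * k}" using alternating_cycle_subset(2)[OF assms] by blast
  then show ?thesis
    using component_eq_mate_closure[OF assms h] unfolding pairing_components_def by blast
qed

lemma pairing_components_cycle:
  assumes m: "m \<in> pair_partitions k" and C: "C \<in> pairing_components k m"
  obtains ys where "alternating_cycle m ys" "C = mate_closure ys" "distinct ys"
    "set ys \<inter> mate ` set ys = {}"
proof -
  obtain x where x: "x \<in> {1..2 * k}" "C = (pairing_adj k m)\<^sup>* `` {x}"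
    using C unfolding pairing_components_def by blast
  obtain ys where ys: "alternating_cycle m ys" "hd ys = x" "distinct ys" "set ys \<inter> mate ` set ys = {}"
    by (rule ex_alternating_cycle[OF m x(1)])
  then have "x \<in> mate_closure ys" by (auto simp: mate_closure_def alternating_cycle_def)
  then have "C = mate_closure ys" using component_eq_mate_closure[OF m ys(1)] x(2) by simp
  then show ?thesis using that ys by blast
qed

lemma pairing_components_disjoint:
  assumes m: "m \<in> pair_partitions k"
    and C: "C \<in> pairing_components k m" and D: "D \<in> pairing_components k m" and "C \<noteq> D"
  shows "C \<inter> D = {}"
proof (rule ccontr)
  assume "C \<inter> D \<noteq> {}"
  then obtain x where "x \<in> C" "x \<in> D" by blast
  then have "C = (pairing_adj k m)\<^sup>* `` {x}" "D = (pairing_adj k m)\<^sup>* `` {x}"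
    using component_eq_mate_closure[OF m] pairing_components_cycle[OF m C] pairing_components_cycle[OF m D]
    by metis+
  then show False using \<open>C \<noteq> D\<close> by simp
qed

lemma Union_pairing_components:
  assumes m: "m \<in> pair_partitions k"
  shows "\<Union>(pairing_components k m) = {1..2 * k}"
proof
  show "\<Union>(pairing_components k m) \<subseteq> {1..2 * k}"
    using alternating_cycle_subset(2)[OF m] pairing_components_cycle[OF m]
    by (metis Union_least)
  show "{1..2 * k} \<subseteq> \<Union>(pairing_components k m)"
    unfolding pairing_components_def by blast
qed

lemma card_pairing_component:
  assumes m: "m \<in> pair_partitions k" and C: "C \<in> pairing_components k m"
  shows "even (card C)" "card C \<ge> 2" "C \<noteq> {}"
proof -
  obtain ys where ys: "alternating_cycle m ys" "C = mate_closure ys" "distinct ys"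
    "set ys \<inter> mate ` set ys = {}" by (rule pairing_components_cycle[OF m C])
  have "card C = 2 * length ys"
    using card_mate_closure[OF _ ys(3,4)] alternating_cycle_subset(1)[OF m ys(1)] ys(2) by fastforce
  moreover have "length ys \<ge> 1" using ys(1) by (cases ys) (auto simp: alternating_cycle_def)
  ultimately show "even (card C)" "card C \<ge> 2" by auto
  then show "C \<noteq> {}" by auto
qed

text \<open>Every component has at least two of the 2k points, so there are at most k components and
  the subtraction in \<open>pairing_norm\<close> is not truncated.\<close>

lemma pairing_norm_plus_card:
  assumes m: "m \<in> pair_partitions k"
  shows "pairing_norm k m + card (pairing_components k m) = k"
proof -
  have "partition_on {1..2 * k} (pairing_components k m)"
  proof (rule partition_onI)
    show "disjnt C D" if "C \<in> pairing_components k m" "D \<in> pairing_components k m" "C \<noteq> D" for C D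
      using pairing_components_disjoint[OF m that] by (simp add: disjnt_def)
    show "{} \<notin> pairing_components k m" using card_pairing_component(3)[OF m] by blast
  qed (rule Union_pairing_components[OF m])
  moreover have "finite C" if "C \<in> pairing_components k m" for C
    using card_pairing_component(2)[OF m that] card.infinite by fastforce
  ultimately have "card {1..2 * k} = (\<Sum>C\<in>pairing_components k m. card C)"
    by (rule product_partition)
  moreover have "(\<Sum>C\<in>pairing_components k m. 2) \<le> (\<Sum>C\<in>pairing_components k m. card C)"
    using card_pairing_component(2)[OF m] by (rule sum_mono)
  ultimately have "card (pairing_components k m) \<le> k" by simp
  then show ?thesis by (simp add: pairing_norm_def coset_type_def)
qed

subsection \<open>Splitting and merging components\<close>

lemma mate_closure_append: "mate_closure (xs @ ys) = mate_closure xs \<union> mate_closure ys"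
  by (auto simp: mate_closure_def)

lemma alternating_cycle_swap_other_component:
  assumes m: "m \<in> pair_partitions k" and E: "E \<in> pairing_components k m" and "i \<notin> E" "j \<notin> E"
  shows "\<exists>zs. alternating_cycle (perm_act (transpose i j) m) zs \<and> E = mate_closure zs"
proof -
  obtain zs where zs: "alternating_cycle m zs" "E = mate_closure zs"
    by (rule pairing_components_cycle[OF m E])
  then have "alternating_cycle (perm_act (transpose i j) m) zs"
    using assms(3,4) by (intro alternating_cycle_swap_unchanged) auto
  then show ?thesis using zs by blast
qed

text \<open>Both swapped points are listed, so the list is cut in front of position s. The weight is
  left as a product over the other components times two Catalan numbers, in order that summing over
  s gives a convolution.\<close>

lemma pairing_components_swap_split:
  assumes m: "m \<in> pair_partitions k" and ys: "alternating_cycle m ys"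
    and dist: "distinct ys" "set ys \<inter> mate ` set ys = {}"
    and s: "1 \<le> s" "s < length ys"
  defines "m' \<equiv> perm_act (transpose (ys ! s) (hd ys)) m"
  shows "card (pairing_components k m') = card (pairing_components k m) + 1"
    and "pairing_weight k m' =
      (\<Prod>C\<in>pairing_components k m - {mate_closure ys}. catalan (card C div 2 - 1)) *
      (catalan (s - 1) * catalan (length ys - s - 1))"
proof -
  let ?i = "ys ! s" and ?j = "hd ys" and ?C = "mate_closure ys"
  define xs zs where "xs = take s ys" and "zs = drop s ys"
  have app: "ys = xs @ zs" by (simp add: xs_def zs_def)
  have ne: "xs \<noteq> []" "zs \<noteq> []" using s by (auto simp: xs_def zs_def)
  have hd: "hd xs = ?j" "hd zs = ?i"
    using s ne by (auto simp: xs_def zs_def hd_drop_conv_nth)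
  have sub: "set ys \<subseteq> {1..2 * k}" by (rule alternating_cycle_subset(1)[OF m ys])
  have i_in: "?i \<in> set ys" "?j \<in> set ys" using s by (auto intro!: hd_in_set)
  then have m': "m' \<in> pair_partitions k"
    unfolding m'_def using sub by (intro perm_act_in_pair_partitions[OF m] permutes_swap_id) auto
  have nm: "mate x \<noteq> y" if "x \<in> set ys" "y \<in> set ys" for x y
    using that dist(2) by (metis disjoint_iff imageI)
  have "alternating_cycle m' xs \<and> alternating_cycle m' zs"
    unfolding m'_def
  proof (subst alternating_cycle_append_iff_swap[symmetric])
    show "mate x \<notin> {?i, ?j}" if "x \<in> set xs \<union> set zs" for x
      using nm[of x] i_in that by (auto simp: app)
    show "y \<notin> {?i, ?j}" if "y \<in> set (tl xs) \<union> set (tl zs)" for y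
    proof -
      have "?j # tl xs = xs" "?i # tl zs = zs"
        using ne hd by (metis list.collapse)+
      then have "distinct ((?j # tl xs) @ (?i # tl zs))"
        using dist(1) app by (simp only:)
      then show ?thesis using that by auto
    qed
    show "alternating_cycle m (xs @ zs)" using ys by (simp add: app)
  qed (use ne hd in auto)
  then have cyc: "alternating_cycle m' xs" "alternating_cycle m' zs" by auto
  have C: "?C \<in> pairing_components k m" by (rule mate_closure_in_pairing_components[OF m ys])
  have CU: "?C = mate_closure xs \<union> mate_closure zs" by (simp add: app mate_closure_append)
  have other: "D \<inter> ?C = {}" if "D \<in> pairing_components k m - {?C}" for D
    using pairing_components_disjoint[OF m _ C] that by blast
  have ij: "?i \<in> ?C" "?j \<in> ?C" using i_in by (auto simp: mate_closure_def)
  let ?P = "insert (mate_closure xs) (insert (mate_closure zs) (pairing_components k m - {?C}))"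
  have comps: "pairing_components k m' = ?P"
  proof (rule pairing_components_eqI[OF m'])
    show "\<exists>ys. alternating_cycle m' ys \<and> D = mate_closure ys" if D: "D \<in> ?P" for D
    proof -
      consider "D = mate_closure xs" | "D = mate_closure zs" | "D \<in> pairing_components k m - {?C}"
        using D by blast
      then show ?thesis
      proof cases
        case 3
        then have "?i \<notin> D" "?j \<notin> D" using other[OF 3] ij by auto
        then show ?thesis
          unfolding m'_def using 3 by (intro alternating_cycle_swap_other_component[OF m]) auto
      qed (use cyc in auto)
    qed
    show "{1..2 * k} \<subseteq> \<Union>?P"
      using Union_pairing_components[OF m] CU by blast
  qed
  \<comment> \<open>The swapped point \<open>ys ! s\<close> lies in the second half only, so the
    halves count as two components.\<close>
  have "?i \<in> set zs" using hd(2) ne(2) hd_in_set by metis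
  then have "?i \<in> mate_closure zs" by (simp add: mate_closure_def)
  moreover have "?i \<notin> mate_closure xs"
  proof
    assume "?i \<in> mate_closure xs"
    then consider "?i \<in> set xs" | x where "x \<in> set xs" "?i = mate x"
      unfolding mate_closure_def by blast
    then show False
    proof cases
      case 1
      moreover have "set xs \<inter> set zs = {}" using dist(1) unfolding app distinct_append by blast
      ultimately show ?thesis using \<open>?i \<in> set zs\<close> by blast
    next
      case (2 x)
      then have "x \<in> set ys" by (simp add: app)
      then show ?thesis using nm[OF _ i_in(1)] 2(2) by metis
    qed
  qed
  ultimately have neq: "mate_closure xs \<noteq> mate_closure zs" by blast
  have notin: "mate_closure us \<notin> pairing_components k m - {?C}" if "us = xs \<or> us = zs" for us
  proof
    assume "mate_closure us \<in> pairing_components k m - {?C}"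
    then have "mate_closure us \<inter> ?C = {}" by (rule other)
    moreover have "mate_closure us \<subseteq> ?C" using that CU by blast
    moreover have "mate_closure us \<noteq> {}" using that ne by (auto simp: mate_closure_def)
    ultimately show False by blast
  qed
  have fin: "finite (pairing_components k m)" by (rule finite_pairing_components)
  have len: "length xs = s" "length zs = length ys - s" using s by (auto simp: xs_def zs_def)
  have cards: "card (mate_closure xs) = 2 * s" "card (mate_closure zs) = 2 * (length ys - s)"
    using sub dist len by (auto simp: app intro!: card_mate_closure)
  have "card ?P = card (pairing_components k m - {?C}) + 2"
    using fin neq notin[of xs] notin[of zs] by simp
  then show "card (pairing_components k m') = card (pairing_components k m) + 1"
    unfolding comps using C fin by (metis Suc_eq_plus1 add_2_eq_Suc' card.remove)
  show "pairing_weight k m' =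
      (\<Prod>C\<in>pairing_components k m - {?C}. catalan (card C div 2 - 1)) *
      (catalan (s - 1) * catalan (length ys - s - 1))"
    unfolding pairing_weight_def comps using fin neq notin[of xs] notin[of zs] cards by simp
qed

text \<open>The point swapped with the head is the mate of a listed point, so the tail after that
  point is glued back reversed, and the component keeps its points.\<close>

lemma pairing_components_swap_stay:
  assumes m: "m \<in> pair_partitions k" and ys: "alternating_cycle m ys"
    and dist: "distinct ys" "set ys \<inter> mate ` set ys = {}"
    and s: "s < length ys"
  shows "pairing_components k (perm_act (transpose (mate (ys ! s)) (hd ys)) m) = pairing_components k m"
proof -
  let ?i = "mate (ys ! s)" and ?j = "hd ys" and ?C = "mate_closure ys"
  let ?m = "perm_act (transpose ?i ?j) m"
  define xs zs where "xs = take (Suc s) ys" and "zs = drop (Suc s) ys"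
  have app: "ys = xs @ zs" by (simp add: xs_def zs_def)
  have xs: "xs \<noteq> []" "hd xs = ?j"
    using s by (auto simp: xs_def)
  have last: "last xs = ys ! s"
    using s by (simp add: xs_def take_Suc_conv_app_nth)
  have sub: "set ys \<subseteq> {1..2 * k}" by (rule alternating_cycle_subset(1)[OF m ys])
  have in_ys: "ys ! s \<in> set ys" "?j \<in> set ys" using s by (auto intro!: hd_in_set)
  then have ij: "?i \<in> ?C" "?j \<in> ?C" by (auto simp: mate_closure_def)
  then have m': "?m \<in> pair_partitions k"
    using alternating_cycle_subset(2)[OF m ys]
    by (intro perm_act_in_pair_partitions[OF m] permutes_swap_id) auto
  have cyc: "alternating_cycle ?m (xs @ map mate (rev zs))"
    using ys dist xs last by (intro alternating_cycle_reverse_tail[OF m]) (auto simp: app)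
  have "mate ` mate ` set zs = set zs"
  proof -
    have "mate (mate z) = z" if "z \<in> set zs" for z using sub that by (auto simp: app)
    then show ?thesis by (simp add: image_image)
  qed
  then have C_eq: "?C = mate_closure (xs @ map mate (rev zs))"
    by (auto simp: app mate_closure_def image_Un)
  have C: "?C \<in> pairing_components k m" by (rule mate_closure_in_pairing_components[OF m ys])
  show ?thesis
  proof (rule pairing_components_eqI[OF m'])
    show "\<exists>ys. alternating_cycle ?m ys \<and> D = mate_closure ys" if D: "D \<in> pairing_components k m" for D
    proof (cases "D = ?C")
      case True
      then show ?thesis using cyc C_eq by blast
    next
      case False
      then have "D \<inter> ?C = {}" using pairing_components_disjoint[OF m D C] by blast
      then have "?i \<notin> D" "?j \<notin> D" using ij by auto
      then show ?thesis using D by (intro alternating_cycle_swap_other_component[OF m]) auto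
    qed
    show "{1..2 * k} \<subseteq> \<Union>(pairing_components k m)"
      using Union_pairing_components[OF m] by blast
  qed
qed

text \<open>Swapping again returns to m, where the two cycles are separate; the splitting criterion
  read backwards joins them. Since the joined component has at most 2k points,
  \<open>catalan_merge_le\<close> gives the factor k^3.\<close>

lemma pairing_components_swap_merge:
  assumes m: "m \<in> pair_partitions k" and ys: "alternating_cycle m ys"
    and dist: "distinct ys" "set ys \<inter> mate ` set ys = {}"
    and i: "i \<in> {1..2 * k}" "i \<notin> mate_closure ys"
  defines "m' \<equiv> perm_act (transpose i (hd ys)) m"
  shows "card (pairing_components k m') + 1 = card (pairing_components k m)"
    and "pairing_weight k m' \<le> real k ^ 3 * pairing_weight k m"
proof -
  let ?j = "hd ys" and ?C = "mate_closure ys"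
  \<comment> \<open>The second cycle is listed from i, so that the swap concerns the heads of both
    lists.\<close>
  obtain zs where zs: "alternating_cycle m zs" "hd zs = i" "distinct zs" "set zs \<inter> mate ` set zs = {}"
    by (rule ex_alternating_cycle[OF m i(1)])
  let ?D = "mate_closure zs"
  have ne: "ys \<noteq> []" "zs \<noteq> []" using ys zs by (auto simp: alternating_cycle_def)
  have in_set: "?j \<in> set ys" "i \<in> set zs" using ne zs(2) by auto
  then have ij: "?j \<in> ?C" "i \<in> ?D" by (auto simp: mate_closure_def)
  have sub: "set ys \<subseteq> {1..2 * k}" "set zs \<subseteq> {1..2 * k}"
    using alternating_cycle_subset(1)[OF m] ys zs(1) by auto
  have C: "?C \<in> pairing_components k m" by (rule mate_closure_in_pairing_components[OF m ys])
  have D: "?D \<in> pairing_components k m" by (rule mate_closure_in_pairing_components[OF m zs(1)])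
  have CD: "?C \<noteq> ?D" using i(2) ij by blast
  then have disj: "?C \<inter> ?D = {}" by (rule pairing_components_disjoint[OF m C D])
  have m': "m' \<in> pair_partitions k"
    unfolding m'_def using i(1) in_set sub
    by (intro perm_act_in_pair_partitions[OF m] permutes_swap_id) auto
  have cyc: "alternating_cycle m' (ys @ zs)"
  proof (subst alternating_cycle_append_iff_swap[where i = i and j = ?j])
    show "mate x \<notin> {i, ?j}" if "x \<in> set ys \<union> set zs" for x
    proof -
      have "x \<in> set ys \<Longrightarrow> mate x \<in> ?C - set ys" "x \<in> set zs \<Longrightarrow> mate x \<in> ?D - set zs"
        using dist(2) zs(4) by (auto simp: mate_closure_def disjoint_iff)
      moreover have "i \<notin> ?C - set ys" "?j \<notin> ?C - set ys" "i \<notin> ?D - set zs" "?j \<notin> ?D - set zs"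
        using ij in_set disj by blast+
      ultimately show ?thesis using that by (metis UnE empty_iff insert_iff)
    qed
    show "y \<notin> {i, ?j}" if "y \<in> set (tl ys) \<union> set (tl zs)" for y
    proof -
      have "y \<in> set (tl ys) \<Longrightarrow> y \<in> ?C - {?j}" "y \<in> set (tl zs) \<Longrightarrow> y \<in> ?D - {i}"
        using dist(1) zs(2,3) ne by (cases ys; cases zs; auto simp: mate_closure_def)+
      moreover have "i \<notin> ?C - {?j}" "?j \<notin> ?C - {?j}" "i \<notin> ?D - {i}" "?j \<notin> ?D - {i}"
        using ij disj by blast+
      ultimately show ?thesis using that by (metis UnE empty_iff insert_iff)
    qed
    show "alternating_cycle (perm_act (transpose i ?j) m') ys \<and>
        alternating_cycle (perm_act (transpose i ?j) m') zs"
      unfolding m'_def perm_act_transpose_twice using ys zs(1) ..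
  qed (use ne zs in auto)
  have other: "E \<inter> (?C \<union> ?D) = {}" if "E \<in> pairing_components k m - {?C, ?D}" for E
    using pairing_components_disjoint[OF m _ C, of E] pairing_components_disjoint[OF m _ D, of E] that
    by blast
  let ?R = "pairing_components k m - {?C, ?D}"
  have comps: "pairing_components k m' = insert (?C \<union> ?D) ?R"
  proof (rule pairing_components_eqI[OF m'])
    show "\<exists>ys. alternating_cycle m' ys \<and> E = mate_closure ys" if E: "E \<in> insert (?C \<union> ?D) ?R" for E
    proof (cases "E = ?C \<union> ?D")
      case True
      then show ?thesis using cyc mate_closure_append by blast
    next
      case False
      then have E: "E \<in> ?R" using E by blast
      then have "i \<notin> E" "?j \<notin> E" using other[OF E] ij by auto
      then show ?thesis
        unfolding m'_def using E by (intro alternating_cycle_swap_other_component[OF m]) auto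
    qed
    show "{1..2 * k} \<subseteq> \<Union>(insert (?C \<union> ?D) ?R)"
      using Union_pairing_components[OF m] by blast
  qed
  have notin: "?C \<union> ?D \<notin> ?R"
    using other[of "?C \<union> ?D"] ij by blast
  have fin: "finite (pairing_components k m)" by (rule finite_pairing_components)
  have eq: "pairing_components k m = insert ?C (insert ?D ?R)" using C D by blast
  have "card (insert ?C (insert ?D ?R)) = card ?R + 2" using fin CD by simp
  moreover have "card (insert (?C \<union> ?D) ?R) = card ?R + 1" using fin notin by simp
  ultimately show "card (pairing_components k m') + 1 = card (pairing_components k m)"
    using comps eq by simp
  define a b where "a = length ys" and "b = length zs"
  have ab: "a \<ge> 1" "b \<ge> 1" using ne by (auto simp: a_def b_def Suc_le_eq)
  have cards: "card ?C = 2 * a" "card ?D = 2 * b"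
    unfolding a_def b_def using sub dist zs by (auto intro!: card_mate_closure)
  have "finite ?C" "finite ?D" by (auto simp: mate_closure_def)
  then have cardU: "card (?C \<union> ?D) = 2 * (a + b)" using cards disj by (simp add: card_Un_disjoint)
  moreover have "card (?C \<union> ?D) \<le> card {1..2 * k}"
    using alternating_cycle_subset(2)[OF m] ys zs(1) by (intro card_mono) auto
  ultimately have abk: "a + b \<le> k" by simp
  let ?Q = "\<Prod>E\<in>?R. catalan (card E div 2 - 1)"
  have Q: "?Q \<ge> 0" by (intro prod_nonneg) (simp add: catalan_pos less_imp_le)
  have w: "pairing_weight k m = ?Q * (catalan (a - 1) * catalan (b - 1))"
    unfolding pairing_weight_def by (subst eq) (use fin CD cards in simp)
  have "pairing_weight k m' = ?Q * catalan (a + b - 1)"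
    unfolding pairing_weight_def comps using fin notin cardU by simp
  also have "\<dots> \<le> ?Q * ((real a + real b) ^ 3 * (catalan (a - 1) * catalan (b - 1)))"
    using catalan_merge_le[OF ab] Q by (rule mult_left_mono)
  also have "\<dots> \<le> ?Q * (real k ^ 3 * (catalan (a - 1) * catalan (b - 1)))"
    using Q abk by (intro mult_left_mono mult_right_mono power_mono mult_nonneg_nonneg)
      (auto simp: catalan_pos less_imp_le)
  also have "\<dots> = real k ^ 3 * pairing_weight k m" by (simp add: w)
  finally show "pairing_weight k m' \<le> real k ^ 3 * pairing_weight k m" .
qed

text \<open>The removed block belongs to both pairings, so it is a component of its own, with weight
  \<open>catalan 0 = 1\<close>. Both k and the number of components drop by one.\<close>

lemma pairing_components_remove_last:
  assumes m: "m \<in> pair_partitions k" and k: "k \<ge> 1" and b: "{2 * k - 1, 2 * k} \<in> m"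
  defines "m' \<equiv> m - {{2 * k - 1, 2 * k}}"
  shows "pairing_norm (k - 1) m' = pairing_norm k m" and "pairing_weight (k - 1) m' = pairing_weight k m"
proof -
  let ?b = "{2 * k - 1, 2 * k}"
  have m': "m' \<in> pair_partitions (k - 1)"
    unfolding m'_def by (rule remove_last_in_pair_partitions[OF m k b])
  have mate: "mate (2 * k - 1) = 2 * k" using k by (simp add: mate_def)
  have cyc: "alternating_cycle m [2 * k - 1]"
  proof -
    have "{mate (2 * k - 1), 2 * k - 1} \<in> m" using b unfolding mate by (simp only: insert_commute)
    then show ?thesis by (simp add: alternating_cycle_def)
  qed
  have cl: "mate_closure [2 * k - 1] = ?b" using mate by (auto simp: mate_closure_def)
  have comps: "pairing_components k m = insert ?b (pairing_components (k - 1) m')"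
  proof (rule pairing_components_eqI[OF m])
    fix C assume "C \<in> insert ?b (pairing_components (k - 1) m')"
    then show "\<exists>ys. alternating_cycle m ys \<and> C = mate_closure ys"
    proof
      assume "C = ?b"
      then show ?thesis using cyc cl by blast
    next
      assume "C \<in> pairing_components (k - 1) m'"
      then obtain ys where ys: "alternating_cycle m' ys" "C = mate_closure ys"
        using pairing_components_cycle[OF m'] by metis
      have "successively (\<lambda>x y. {mate x, y} \<in> m) ys"
        by (rule successively_mono[of "\<lambda>x y. {mate x, y} \<in> m'"])
          (use ys(1) in \<open>auto simp: alternating_cycle_def m'_def\<close>)
      then have "alternating_cycle m ys"
        using ys(1) by (simp add: alternating_cycle_def m'_def)
      then show ?thesis using ys(2) by blast
    qed
  next
    have "{1..2 * k} = {1..2 * (k - 1)} \<union> ?b" using k by auto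
    then show "{1..2 * k} \<subseteq> \<Union>(insert ?b (pairing_components (k - 1) m'))"
      using Union_pairing_components[OF m'] by auto
  qed
  have notin: "?b \<notin> pairing_components (k - 1) m'"
  proof
    assume "?b \<in> pairing_components (k - 1) m'"
    then have "?b \<subseteq> {1..2 * (k - 1)}" using Union_pairing_components[OF m'] by blast
    then show False using k by auto
  qed
  have fin: "finite (pairing_components (k - 1) m')" by (rule finite_pairing_components)
  have "card ?b = 2" using k by simp
  then show "pairing_weight (k - 1) m' = pairing_weight k m"
    unfolding pairing_weight_def comps using fin notin by simp
  have "card (pairing_components k m) = card (pairing_components (k - 1) m') + 1"
    unfolding comps using fin notin by simp
  then show "pairing_norm (k - 1) m' = pairing_norm k m"
    using pairing_norm_plus_card[OF m] pairing_norm_plus_card[OF m'] k by linarith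
qed

subsection \<open>Geodesics and the upper bound\<close>

text \<open>Catalan's recursion for a component of size 2a. The value 0 for a = 1 is made up for by
  the dashed arrow.\<close>

lemma sum_catalan_split:
  "(\<Sum>s\<in>{1..<a}. catalan (s - 1) * catalan (a - s - 1)) = (if a \<ge> 2 then catalan (a - 1) else 0)"
proof (cases "a \<ge> 2")
  case True
  then obtain n where a: "a = Suc (Suc n)" by (metis Suc_le_D numeral_2_eq_2 Suc_le_mono)
  have "(\<Sum>s\<in>{1..<a}. catalan (s - 1) * catalan (a - s - 1))
      = (\<Sum>i\<in>{..n}. catalan i * catalan (n - i))"
    by (rule sum.reindex_bij_witness[of _ Suc "\<lambda>s. s - 1"]) (auto simp: a)
  then show ?thesis using True by (simp add: catalan_convolution a)
qed simp

text \<open>All that the counting needs to know about the arrows out of m. S consists of the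
  splitting arrows, and the last conclusion is the recursion for the weight, in the shape of
  \<open>card_weingarten_paths\<close> restricted to splitting and dashed arrows.\<close>

lemma swap_last_effects:
  assumes m: "m \<in> pair_partitions k" and k: "k \<ge> 1"
  obtains S where "S \<subseteq> {1..<2 * k - 1}"
    and "\<forall>i\<in>S. pairing_norm k (swap_last k i m) + 1 = pairing_norm k m"
    and "\<forall>i\<in>{1..<2 * k - 1} - S.
      pairing_norm k (swap_last k i m) = pairing_norm k m \<and>
        pairing_weight k (swap_last k i m) = pairing_weight k m \<or>
      pairing_norm k (swap_last k i m) = pairing_norm k m + 1 \<and>
        pairing_weight k (swap_last k i m) \<le> real k ^ 3 * pairing_weight k m"
    and "(\<Sum>i\<in>S. pairing_weight k (swap_last k i m)) +
      (if {2 * k - 1, 2 * k} \<in> m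
       then pairing_weight (k - 1) (m - {{2 * k - 1, 2 * k}}) else 0) = pairing_weight k m"
proof -
  let ?v = "2 * k - 1" and ?I = "{1..<2 * k - 1}"
  let ?W = "pairing_weight k" and ?N = "pairing_norm k"
  have v: "?v \<in> {1..2 * k}" using k by auto
  have mate_v: "mate ?v = 2 * k" using k by (simp add: mate_def)
  obtain ys where ys: "alternating_cycle m ys" "hd ys = ?v" "distinct ys" "set ys \<inter> mate ` set ys = {}"
    by (rule ex_alternating_cycle[OF m v])
  define a where "a = length ys"
  have a: "a \<ge> 1" "ys ! 0 = ?v" using ys by (auto simp: a_def alternating_cycle_def hd_conv_nth Suc_le_eq)
  have sub: "set ys \<subseteq> {1..2 * k}" by (rule alternating_cycle_subset(1)[OF m ys(1)])
  have v_in: "?v \<in> set ys" using ys(1,2) hd_in_set[of ys] by (simp add: alternating_cycle_def)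
  have I: "i \<in> ?I \<longleftrightarrow> i \<in> {1..2 * k} \<and> i \<noteq> ?v \<and> i \<noteq> mate ?v" for i
    unfolding mate_v using k by auto
  \<comment> \<open>Position 0 is left out: it holds 2k - 1 itself.\<close>
  define S where "S = (\<lambda>s. ys ! s) ` {1..<a}"
  have S_I: "S \<subseteq> ?I"
  proof
    fix i assume "i \<in> S"
    then obtain s where s: "i = ys ! s" "1 \<le> s" "s < a" by (auto simp: S_def)
    then have "i \<in> set ys" by (simp add: a_def)
    moreover have "0 < length ys" using s by (simp only: a_def)
    then have "ys ! s \<noteq> ys ! 0"
      using s nth_eq_iff_index_eq[OF ys(3), of s 0] by (simp add: a_def)
    then have "i \<noteq> ?v" using s a by simp
    moreover have "i \<noteq> mate ?v" using calculation(1) v_in ys(4) by blast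
    ultimately show "i \<in> ?I" using sub unfolding I by blast
  qed
  have perm: "swap_last k i m \<in> pair_partitions k" if "i \<in> ?I" for i
    by (rule swap_last_in_pair_partitions[OF m that])
  have norm: "?N x + card (pairing_components k x) = k" if "x \<in> pair_partitions k" for x
    by (rule pairing_norm_plus_card[OF that])
  let ?Q = "\<Prod>C\<in>pairing_components k m - {mate_closure ys}. catalan (card C div 2 - 1)"
  have split: "card (pairing_components k (swap_last k (ys ! s) m)) = card (pairing_components k m) + 1"
    "?W (swap_last k (ys ! s) m) = ?Q * (catalan (s - 1) * catalan (a - s - 1))"
    if "s \<in> {1..<a}" for s
    using pairing_components_swap_split[OF m ys(1,3,4), of s] that unfolding ys(2) a_def by auto
  have S_norm: "?N (swap_last k i m) + 1 = ?N m" if i: "i \<in> S" for i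
  proof -
    obtain s where s: "i = ys ! s" "s \<in> {1..<a}" using i unfolding S_def by blast
    have "i \<in> ?I" using i S_I by blast
    then show ?thesis using norm[OF m] norm[OF perm] split(1)[OF s(2)] s(1) by fastforce
  qed
  have other: "?N (swap_last k i m) = ?N m \<and> ?W (swap_last k i m) = ?W m \<or>
      ?N (swap_last k i m) = ?N m + 1 \<and> ?W (swap_last k i m) \<le> real k ^ 3 * ?W m"
    if i: "i \<in> ?I - S" for i
  proof (cases "i \<in> mate_closure ys")
    case True
    \<comment> \<open>All listed points other than 2k - 1 are in S, so i can only be the mate of a
      listed point.\<close>
    have "i \<notin> set ys"
    proof
      assume "i \<in> set ys"
      then obtain s where s: "s < a" "i = ys ! s" by (auto simp: in_set_conv_nth a_def)
      have "s \<noteq> 0"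
      proof
        assume "s = 0"
        then show False using i s a(2) by simp
      qed
      then show False using s i by (auto simp: S_def)
    qed
    then obtain y where "y \<in> set ys" "i = mate y" using True by (auto simp: mate_closure_def)
    then obtain s where s: "s < length ys" "i = mate (ys ! s)" by (auto simp: in_set_conv_nth)
    have "pairing_components k (swap_last k i m) = pairing_components k m"
      using pairing_components_swap_stay[OF m ys(1,3,4) s(1)] unfolding ys(2) s(2) .
    then show ?thesis using norm[OF m] norm[OF perm, of i] i by (simp add: pairing_weight_def)
  next
    case False
    have "i \<in> {1..2 * k}" using i by auto
    note merge = pairing_components_swap_merge[OF m ys(1,3,4) this False, unfolded ys(2)]
    have "?N (swap_last k i m) = ?N m + 1"
      using norm[OF m] norm[OF perm, of i] i merge(1) by auto
    then show ?thesis using merge(2) by blast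
  qed
  have fin: "finite (pairing_components k m)" by (rule finite_pairing_components)
  have cl: "mate_closure ys \<in> pairing_components k m"
    by (rule mate_closure_in_pairing_components[OF m ys(1)])
  have "card (mate_closure ys) = 2 * a"
    unfolding a_def using sub ys by (auto intro!: card_mate_closure)
  then have W: "?W m = ?Q * catalan (a - 1)"
    unfolding pairing_weight_def by (subst prod.remove[OF fin cl]) simp
  have inj: "inj_on (\<lambda>s. ys ! s) {1..<a}"
    using ys(3) by (intro inj_on_nth) (auto simp: a_def)
  have "(\<Sum>i\<in>S. ?W (swap_last k i m)) = (\<Sum>s\<in>{1..<a}. ?W (swap_last k (ys ! s) m))"
    unfolding S_def by (subst sum.reindex[OF inj]) simp
  also have "\<dots> = (\<Sum>s\<in>{1..<a}. ?Q * (catalan (s - 1) * catalan (a - s - 1)))"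
    by (rule sum.cong) (simp_all only: split(2))
  also have "\<dots> = ?Q * (if a \<ge> 2 then catalan (a - 1) else 0)"
    unfolding sum_distrib_left[symmetric] sum_catalan_split ..
  finally have sum: "(\<Sum>i\<in>S. ?W (swap_last k i m)) = (if a \<ge> 2 then ?W m else 0)"
    using W by simp
  have dashed: "{?v, 2 * k} \<in> m \<longleftrightarrow> a = 1"
  proof
    assume "a = 1"
    then have "ys = [?v]" using a by (cases ys) (auto simp: a_def)
    then have "{mate ?v, ?v} \<in> m" using ys(1) by (simp add: alternating_cycle_def)
    then show "{?v, 2 * k} \<in> m" unfolding mate_v by (simp only: insert_commute)
  next
    assume b: "{?v, 2 * k} \<in> m"
    show "a = 1"
    proof (rule ccontr)
      assume "a \<noteq> 1"
      then have a2: "Suc 0 < length ys" using a by (simp add: a_def)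
      then have "{mate ?v, ys ! 1} \<in> m"
        using ys(1) successively_nth[of _ ys 0] a(2) by (auto simp: alternating_cycle_def)
      moreover have "{mate ?v, ?v} \<in> m" using b unfolding mate_v by (simp only: insert_commute)
      ultimately have "ys ! 1 = ys ! 0" using pair_unique[OF m] a(2) by metis
      then show False using a2 nth_eq_iff_index_eq[OF ys(3) a2, of 0] by fastforce
    qed
  qed
  \<comment> \<open>For a = 1 nothing splits and the dashed arrow carries the whole weight; for
    larger a there is no dashed arrow and the splits carry it.\<close>
  have total: "(\<Sum>i\<in>S. ?W (swap_last k i m)) +
      (if {?v, 2 * k} \<in> m then pairing_weight (k - 1) (m - {{?v, 2 * k}}) else 0) = ?W m"
  proof (cases "a = 1")
    case True
    then show ?thesis using sum dashed pairing_components_remove_last(2)[OF m k] by simp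
  next
    case False
    then show ?thesis using sum dashed a by simp
  qed
  show ?thesis using S_norm other by (intro that[OF S_I _ _ total]) blast+
qed

section \<open>Counting geodesics\<close>

lemma pairing_weight_nonneg: "pairing_weight k m \<ge> 0"
  unfolding pairing_weight_def by (intro prod_nonneg) (simp add: catalan_pos less_imp_le)

text \<open>A solid arrow lowers the norm by at most one and a dashed arrow keeps it, so no path has
  fewer solid arrows than the norm. With exactly that many, every solid arrow must split a
  component, and the count follows the recursion for the weight.\<close>

lemma card_weingarten_paths_le_norm:
  assumes "m \<in> pair_partitions k" "l \<le> pairing_norm k m"
  shows "real (card (weingarten_paths k m l)) = (if l = pairing_norm k m then pairing_weight k m else 0)"
  using assms
proof (induction "k + l" arbitrary: k l m rule: less_induct)
  case less
  let ?W = "pairing_weight" and ?N = "pairing_norm"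
  have m: "m \<in> pair_partitions k" by fact
  show ?case
  proof (cases "k = 0")
    case True
    then have "m = {}" using m pair_partitions_0 by auto
    moreover have "pairing_components 0 {} = {}" by (simp add: pairing_components_def)
    moreover have "?N 0 {} = 0" by (simp add: pairing_norm_def)
    ultimately show ?thesis using True less.prems(2)
      by (simp add: weingarten_paths_0 pairing_weight_def)
  next
    case False
    then have k: "k \<ge> 1" by simp
    let ?b = "{2 * k - 1, 2 * k}" and ?I = "{1..<2 * k - 1}"
    obtain S where S: "S \<subseteq> ?I"
      and S_norm: "\<forall>i\<in>S. ?N k (swap_last k i m) + 1 = ?N k m"
      and other: "\<forall>i\<in>?I - S.
        ?N k (swap_last k i m) = ?N k m \<and> ?W k (swap_last k i m) = ?W k m \<or>
        ?N k (swap_last k i m) = ?N k m + 1 \<and> ?W k (swap_last k i m) \<le> real k ^ 3 * ?W k m"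
      and total: "(\<Sum>i\<in>S. ?W k (swap_last k i m)) + (if ?b \<in> m then ?W (k - 1) (m - {?b}) else 0) = ?W k m"
      by (rule swap_last_effects[OF m k])
    let ?c = "\<lambda>i. if l = 0 then 0 else real (card (weingarten_paths k (swap_last k i m) (l - 1)))"
    have cS: "?c i = (if l = ?N k m then ?W k (swap_last k i m) else 0)" if "i \<in> S" for i
    proof (cases "l = 0")
      case True
      then show ?thesis using bspec[OF S_norm that] by simp
    next
      case False
      have "i \<in> ?I" using that S by blast
      from less.hyps[OF _ swap_last_in_pair_partitions[OF m this], of "l - 1"]
      show ?thesis using False less.prems(2) bspec[OF S_norm that] by auto
    qed
    \<comment> \<open>The remaining l - 1 solid arrows are fewer than the norm of the target, so
      this direction contributes no path.\<close>
    have cO: "?c i = 0" if "i \<in> ?I - S" for i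
    proof (cases "l = 0")
      case False
      have "l - 1 < ?N k (swap_last k i m)" using bspec[OF other that] False less.prems(2) by auto
      then show ?thesis
        using less.hyps[OF _ swap_last_in_pair_partitions[OF m, of i], of "l - 1"] that False by auto
    qed simp
    have "real (card (weingarten_paths k m l)) = (\<Sum>i\<in>?I. ?c i) +
      (if ?b \<in> m then real (card (weingarten_paths (k - 1) (m - {?b}) l)) else 0)"
      unfolding card_weingarten_paths[OF m k] by (simp add: if_distrib cong: if_cong)
    also have "(\<Sum>i\<in>?I. ?c i) = (\<Sum>i\<in>S. ?c i)"
      using S cO by (intro sum.mono_neutral_right) auto
    also have "\<dots> = (if l = ?N k m then \<Sum>i\<in>S. ?W k (swap_last k i m) else 0)"
      using cS by simp
    also have "(if ?b \<in> m then real (card (weingarten_paths (k - 1) (m - {?b}) l)) else 0)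
      = (if l = ?N k m then if ?b \<in> m then ?W (k - 1) (m - {?b}) else 0 else 0)"
      using less.hyps[OF _ remove_last_in_pair_partitions[OF m k], of l] k less.prems(2)
        pairing_components_remove_last(1)[OF m k] by auto
    finally show ?thesis using total by (auto split: if_splits)
  qed
qed

text \<open>Cut a path at its first step that does not lower the norm. There are at most
  \<open>k + |m| \<le> 2K - 1\<close> positions for this step and at most \<open>2K - 2\<close> arrows to choose from; the initial
  segments, weighted by the number of geodesics from their endpoints, are counted by the geodesics
  from \<open>m\<close>.\<close>

lemma card_weingarten_paths_upper:
  assumes B1: "real K ^ 3 \<le> B" and B2: "(2 * real K - 1) * (2 * real K - 2) \<le> B" and B0: "0 \<le> B"
    and "k \<le> K" "m \<in> pair_partitions k" "K \<ge> 1"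
  shows "real (card (weingarten_paths k m (pairing_norm k m + g))) \<le> B ^ g * pairing_weight k m"
  using assms(4,5)
proof (induction g arbitrary: k m rule: less_induct)
  case (less g)
  let ?W = "pairing_weight" and ?N = "pairing_norm"
  show ?case
  proof (cases "g = 0")
    case True
    then show ?thesis using card_weingarten_paths_le_norm[OF less.prems(2)] by simp
  next
    case False
    then have g: "g \<ge> 1" by simp
    \<comment> \<open>At most 2K - 2 choices for the first arrow that does not lower the norm, times
      the bound for the excess left after it.\<close>
    define D where "D = (2 * real K - 2) * B ^ (g - 1)"
    have D0: "D \<ge> 0" unfolding D_def using B0 \<open>K \<ge> 1\<close> by simp
    \<comment> \<open>Splitting and dashed arrows keep the excess and lower k + |m| by one. This sum
      is thus the measure of the inner induction, and it bounds the number of possible positions of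
      the cut.\<close>
    have *: "real (card (weingarten_paths k m (?N k m + g))) \<le> (real k + real (?N k m)) * D * ?W k m"
      if "k \<le> K" "m \<in> pair_partitions k" for k m
      using that
    proof (induction "k + ?N k m" arbitrary: k m rule: less_induct)
      case inner: less
      have m: "m \<in> pair_partitions k" by fact
      show ?case
      proof (cases "k = 0")
        case True
        then have "m = {}" using m pair_partitions_0 by auto
        then show ?thesis using True g by (simp add: weingarten_paths_0 pairing_norm_def)
      next
        case False
        then have k: "k \<ge> 1" by simp
        let ?b = "{2 * k - 1, 2 * k}" and ?I = "{1..<2 * k - 1}"
        obtain S where S: "S \<subseteq> ?I"
          and S_norm: "\<forall>i\<in>S. ?N k (swap_last k i m) + 1 = ?N k m"
          and other: "\<forall>i\<in>?I - S.
            ?N k (swap_last k i m) = ?N k m \<and> ?W k (swap_last k i m) = ?W k m \<or>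
            ?N k (swap_last k i m) = ?N k m + 1 \<and> ?W k (swap_last k i m) \<le> real k ^ 3 * ?W k m"
          and total: "(\<Sum>i\<in>S. ?W k (swap_last k i m)) +
            (if ?b \<in> m then ?W (k - 1) (m - {?b}) else 0) = ?W k m"
          by (rule swap_last_effects[OF m k])
        \<comment> \<open>The factor of the inner induction hypothesis at a target, where k + |m| is
          smaller by one.\<close>
        define r where "r = (real k + real (?N k m) - 1) * D"
        let ?c = "\<lambda>i. real (card (weingarten_paths k (swap_last k i m) (?N k m + g - 1)))"
        have cS: "?c i \<le> r * ?W k (swap_last k i m)" if "i \<in> S" for i
        proof -
          have i: "i \<in> ?I" using that S by blast
          have n: "?N k m = ?N k (swap_last k i m) + 1" using bspec[OF S_norm that] by simp
          show ?thesis
            using inner.hyps[OF _ inner.prems(1) swap_last_in_pair_partitions[OF m i]]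
            by (simp add: n r_def)
        qed
        have cO: "?c i \<le> B ^ (g - 1) * ?W k m" if i: "i \<in> ?I - S" for i
        proof -
          have m': "swap_last k i m \<in> pair_partitions k"
            using i by (intro swap_last_in_pair_partitions[OF m]) auto
          consider "?N k (swap_last k i m) = ?N k m" "?W k (swap_last k i m) = ?W k m"
            | "?N k (swap_last k i m) = ?N k m + 1" "?W k (swap_last k i m) \<le> real k ^ 3 * ?W k m"
            using bspec[OF other i] by blast
          then show ?thesis
          proof cases
            case 1
            then show ?thesis
              using less.IH[of "g - 1" k "swap_last k i m"] g m' inner.prems(1) by simp
          next
            case 2
            show ?thesis
            proof (cases "g = 1")
              case True
              \<comment> \<open>The target has larger norm than there are solid arrows left, so
                there is no path at all.\<close>
              then show ?thesis
                using card_weingarten_paths_le_norm[OF m', of "?N k m"] 2 pairing_weight_nonneg by simp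
            next
              case False
              then have "g = Suc (Suc (g - 2))" using g by linarith
              then obtain h where h: "g = Suc (Suc h)" by blast
              \<comment> \<open>The norm rises by one while one solid arrow is spent, so the excess
                drops by two; the spare factor B then pays for k^3.\<close>
              have "?c i \<le> B ^ h * ?W k (swap_last k i m)"
                using less.IH[of h k "swap_last k i m"] h m' inner.prems(1) 2 by simp
              also have "\<dots> \<le> B ^ h * (real k ^ 3 * ?W k m)"
                using 2 B0 by (intro mult_left_mono) auto
              also have "\<dots> \<le> B ^ h * (B * ?W k m)"
              proof -
                have "real k ^ 3 \<le> real K ^ 3" using inner.prems(1) by (intro power_mono) auto
                then have "real k ^ 3 \<le> B" using B1 by linarith
                then show ?thesis using B0 pairing_weight_nonneg
                  by (intro mult_left_mono mult_right_mono) auto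
              qed
              finally show ?thesis using h by (simp add: mult_ac)
            qed
          qed
        qed
        have sumO: "(\<Sum>i\<in>?I - S. ?c i) \<le> D * ?W k m"
        proof -
          have "(\<Sum>i\<in>?I - S. ?c i) \<le> real (card (?I - S)) * (B ^ (g - 1) * ?W k m)"
            using cO by (rule sum_bounded_above)
          also have "card (?I - S) \<le> card ?I" by (intro card_mono) auto
          then have "card (?I - S) \<le> 2 * K - 2" using inner.prems(1) by simp
          then have "real (card (?I - S)) \<le> 2 * real K - 2" using \<open>K \<ge> 1\<close> by linarith
          then have "real (card (?I - S)) * (B ^ (g - 1) * ?W k m)
              \<le> (2 * real K - 2) * (B ^ (g - 1) * ?W k m)"
            using B0 pairing_weight_nonneg by (intro mult_right_mono) auto
          finally show ?thesis by (simp add: D_def mult.assoc)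
        qed
        have dash: "real (card (weingarten_paths (k - 1) (m - {?b}) (?N k m + g)))
            \<le> r * ?W (k - 1) (m - {?b})" if b: "?b \<in> m"
        proof -
          have n: "?N k m = ?N (k - 1) (m - {?b})"
            using pairing_components_remove_last(1)[OF m k b] by simp
          show ?thesis
            using inner.hyps[OF _ _ remove_last_in_pair_partitions[OF m k b]] inner.prems(1) k n
            by (simp add: r_def of_nat_diff algebra_simps)
        qed
        have "real (card (weingarten_paths k m (?N k m + g))) = (\<Sum>i\<in>?I. ?c i) +
          (if ?b \<in> m then real (card (weingarten_paths (k - 1) (m - {?b}) (?N k m + g))) else 0)"
          using card_weingarten_paths[OF m k, of "?N k m + g"] g by simp
        also have "(\<Sum>i\<in>?I. ?c i) = (\<Sum>i\<in>?I - S. ?c i) + (\<Sum>i\<in>S. ?c i)"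
          using S by (intro sum.subset_diff) auto
        also have "(\<Sum>i\<in>S. ?c i) \<le> r * (\<Sum>i\<in>S. ?W k (swap_last k i m))"
          unfolding sum_distrib_left using cS by (rule sum_mono)
        finally have "real (card (weingarten_paths k m (?N k m + g))) \<le>
            D * ?W k m + r * (\<Sum>i\<in>S. ?W k (swap_last k i m)) +
            (if ?b \<in> m then r * ?W (k - 1) (m - {?b}) else 0)"
          using sumO dash by (auto split: if_splits)
        \<comment> \<open>The recursion for the weight collects the splitting and dashed
          contributions into the weight of m.\<close>
        also have "\<dots> = D * ?W k m + r * ?W k m"
          unfolding total[symmetric] by (auto simp: distrib_left)
        also have "\<dots> = (real k + real (?N k m)) * D * ?W k m"
          unfolding r_def by (simp add: algebra_simps)
        finally show ?thesis .
      qed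
    qed
    show ?thesis
    proof (cases "k = 0")
      case True
      then have "real (card (weingarten_paths k m (?N k m + g))) \<le> 0"
        using *[OF less.prems] by (simp add: pairing_norm_def)
      then show ?thesis using B0 pairing_weight_nonneg[of k m]
        by (meson mult_nonneg_nonneg order_trans zero_le_power)
    next
      case False
      \<comment> \<open>For positive k there is a component, so the norm is at most k - 1; this is
        where 2K - 1 comes from.\<close>
      have "card (pairing_components k m) \<ge> 1"
        using Union_pairing_components[OF less.prems(2)] finite_pairing_components[of k m] False
        by (cases "pairing_components k m = {}") (auto simp: Suc_le_eq card_gt_0_iff)
      then have "k + ?N k m \<le> 2 * K - 1"
        using pairing_norm_plus_card[OF less.prems(2)] less.prems(1) by linarith
      then have "real k + real (?N k m) \<le> 2 * real K - 1" using \<open>K \<ge> 1\<close> by linarith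
      then have "(real k + real (?N k m)) * D \<le> (2 * real K - 1) * D"
        using D0 by (rule mult_right_mono)
      also have "\<dots> = ((2 * real K - 1) * (2 * real K - 2)) * B ^ (g - 1)"
        by (simp add: D_def)
      also have "\<dots> \<le> B * B ^ (g - 1)" using B2 B0 by (intro mult_right_mono) auto
      also have "\<dots> = B ^ g" using g by (simp add: power_eq_if)
      finally have "(real k + real (?N k m)) * D * ?W k m \<le> B ^ g * ?W k m"
        using pairing_weight_nonneg by (intro mult_right_mono)
      then show ?thesis using *[OF less.prems] by linarith
    qed
  qed
qed

theorem theorem4p9:
  fixes k g :: nat and m :: "nat set set"
  assumes "k \<ge> 1"
    and "m \<in> pair_partitions k"
  shows "card (weingarten_paths k m (pairing_norm k m + 2 * g))
           \<ge> (2 * k - 2) ^ g * card (weingarten_paths k m (pairing_norm k m)) \<and>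
         real (card (weingarten_paths k m (pairing_norm k m + g)))
           \<le> (12 * real k powr (7 / 2)) ^ g * real (card (weingarten_paths k m (pairing_norm k m)))"
proof
  show "card (weingarten_paths k m (pairing_norm k m + 2 * g))
      \<ge> (2 * k - 2) ^ g * card (weingarten_paths k m (pairing_norm k m))"
    by (rule card_weingarten_paths_add_even[OF assms(2,1)])
  let ?B = "12 * real k powr (7 / 2)"
  have k: "real k \<ge> 1" using assms(1) by simp
  \<comment> \<open>Both conditions on B follow from k^3 <= k^(7/2) and (2k-1)(2k-2) <= 4k^2 <=
    4k^3.\<close>
  have "real k ^ 3 = real k powr 3" using k by (simp add: powr_numeral)
  also have "\<dots> \<le> real k powr (7 / 2)" using k by (intro powr_mono) auto
  finally have p3: "real k ^ 3 \<le> real k powr (7 / 2)" .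
  have "real k * real k \<le> real k ^ 3"
    using mult_left_mono[OF k, of "real k * real k"] by (simp add: power3_eq_cube)
  moreover have "(2 * real k - 1) * (2 * real k - 2) \<le> 4 * (real k * real k)"
    using k by (simp add: algebra_simps)
  moreover have p0: "real k powr (7 / 2) \<ge> 0" by simp
  ultimately have "real k ^ 3 \<le> ?B" "(2 * real k - 1) * (2 * real k - 2) \<le> ?B" "0 \<le> ?B"
    using p3 by linarith+
  from card_weingarten_paths_upper[OF this le_refl assms(2,1), of g]
  show "real (card (weingarten_paths k m (pairing_norm k m + g)))
      \<le> ?B ^ g * real (card (weingarten_paths k m (pairing_norm k m)))"
    using card_weingarten_paths_le_norm[OF assms(2) le_refl] by simp
qed

end
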